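(* Let $M$ be a loopless matroid. For each $\mathcal{F} \in \mathcal{N}^\circ(M)$, \[ \overline{P}_M^\mathcal{F}(q^{-1}) = q^{-(\operatorname{rk} M - 1 - \# \mathcal{F})} \overline{P}_M^\mathcal{F}(q) \in \mathbb{Z}[q^{\pm 1}]. \]
   Context: Let $M$ be a matroid on ground set $E$ with lattice of flats $\mathcal{L}$; $\overline{\chi}_N=\chi_N/(q-1)$ is the reduced characteristic polynomial. $\mathcal{N}(M)$ is the set of flags of flats strictly containing $\operatorname{cl}(\emptyset)$, and $\mathcal{N}^\circ(M)$ the flags not containing $E$. For a flag $\mathcal{G}$, $M_\mathcal{G}$ is the matroid $M_w$ for $w$ in the relative interior of the cone spanned by the indicator vectors of flats in $\mathcal{G}$ ($M_w$ having as bases the bases $B$ of $M$ maximizing $\sum_{e\in B}w_e$); for loopless $M$, $M_\mathcal{G}=\bigoplus_{G\in\mathcal{G}\cup\{E\}}M|G/z(G)$, $z(G)$ the largest flat of $\mathcal{G}$ strictly below $G$ (or $\emptyset$). The Poincaré polynomial of $M$ at $\mathcal{F}\in\mathcal{N}^\circ(M)$ is $\overline{P}_M^\mathcal{F}(q)=\sum_{\mathcal{G}\in\mathcal{N}^\circ(M),\,\mathcal{G}\supseteq\mathcal{F}}\overline{\chi}_{M_\mathcal{G}}(q)/(q-1)^{\#\mathcal{G}}\in\mathbb{Z}[q]$, a polynomial of degree $\operatorname{rk}M-1-\#\mathcal{F}$. *)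

theory Defs
  imports Complex_Main "HOL-Library.Indicator_Function"
    "HOL-Computational_Algebra.Polynomial_Factorial"
begin

section \<open>Matroids given by their bases\<close>

record 'a matroid_data =
  ground :: "'a set"
  bases :: "'a set set"

locale matroid =
  fixes M :: "'a matroid_data"
  assumes finite_ground: "finite (ground M)"
    and basis_subset_ground: "B \<in> bases M \<Longrightarrow> B \<subseteq> ground M"
    and ex_basis: "bases M \<noteq> {}"
    and basis_exchange: "\<lbrakk>A \<in> bases M; B \<in> bases M; x \<in> A - B\<rbrakk>
      \<Longrightarrow> \<exists>y\<in>B - A. insert y (A - {x}) \<in> bases M"

definition rank :: "'a matroid_data \<Rightarrow> 'a set \<Rightarrow> nat" where
  "rank M A = Max ((\<lambda>B. card (A \<inter> B)) ` bases M)"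

definition rk :: "'a matroid_data \<Rightarrow> nat" where
  "rk M = rank M (ground M)"

definition closure :: "'a matroid_data \<Rightarrow> 'a set \<Rightarrow> 'a set" where
  "closure M A = {e \<in> ground M. rank M (insert e A) = rank M A}"

definition flats :: "'a matroid_data \<Rightarrow> 'a set set" where
  "flats M = {F. F \<subseteq> ground M \<and> closure M F = F}"

definition loopless :: "'a matroid_data \<Rightarrow> bool" where
  "loopless M \<longleftrightarrow> (\<forall>e\<in>ground M. \<exists>B\<in>bases M. e \<in> B)"


section \<open>Characteristic polynomial\<close>

text \<open>
  The Moebius function of a family \<open>L\<close> of finite sets ordered by inclusion.  The finiteness
  guard only serves to make the recursion terminate.
\<close>

function moebius :: "'a set set \<Rightarrow> 'a set \<Rightarrow> 'a set \<Rightarrow> int" where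
  "moebius L X Y =
    (if X = Y then 1
     else if X \<subset> Y \<and> finite Y then - (\<Sum>Z\<in>{Z\<in>L. X \<subseteq> Z \<and> Z \<subset> Y}. moebius L X Z)
     else 0)"
  by pat_completeness auto
termination
  by (relation "measure (\<lambda>(L, X, Y). card Y)") (auto intro: psubset_card_mono)

declare moebius.simps [simp del]

definition char_poly :: "'a matroid_data \<Rightarrow> int poly" where
  "char_poly M =
    (\<Sum>F\<in>flats M. monom (moebius (flats M) (closure M {}) F) (rk M - rank M F))"

text \<open>
  The variable \<open>q\<close>, as an element of the field of fractions of \<open>\<int>[q]\<close>, which contains the
  Laurent polynomial ring \<open>\<int>[q, q\<^sup>-\<^sup>1]\<close>.
\<close>

definition q :: "int poly fract" where
  "q = to_fract [:0, 1:]"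

definition reduced_char_poly :: "'a matroid_data \<Rightarrow> int poly fract" where
  "reduced_char_poly M = to_fract (char_poly M) / (q - 1)"


section \<open>Flags of flats and the associated initial matroids\<close>

text \<open>Flags are chains, the empty one included.\<close>

definition flags :: "'a matroid_data \<Rightarrow> 'a set set set" where
  "flags M = {\<G>. subset.chain {F \<in> flats M. closure M {} \<subset> F} \<G>}"

definition proper_flags :: "'a matroid_data \<Rightarrow> 'a set set set" where
  "proper_flags M = {\<G> \<in> flags M. ground M \<notin> \<G>}"

definition initial_matroid :: "'a matroid_data \<Rightarrow> ('a \<Rightarrow> real) \<Rightarrow> 'a matroid_data" where
  "initial_matroid M w =
    \<lparr>ground = ground M, bases = {B \<in> bases M. \<forall>B'\<in>bases M. sum w B' \<le> sum w B}\<rparr>"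

text \<open>
  A point of the relative interior of the cone spanned by the indicator vectors of the members
  of \<open>\<G>\<close> is a combination of them with positive coefficients.  We take all coefficients to be 1;
  \<open>flag_matroid_eq\<close> below shows that the choice does not matter.
\<close>

definition flag_matroid :: "'a matroid_data \<Rightarrow> 'a set set \<Rightarrow> 'a matroid_data" where
  "flag_matroid M \<G> = initial_matroid M (\<lambda>e. \<Sum>G\<in>\<G>. indicator G e)"

context matroid
begin

lemma finite_bases: "finite (bases M)"
  by (rule finite_subset[of _ "Pow (ground M)"]) (use finite_ground basis_subset_ground in auto)

lemma finite_basis: "B \<in> bases M \<Longrightarrow> finite B"
  using basis_subset_ground finite_ground finite_subset by blast

lemma card_inter_le_rank: "B \<in> bases M \<Longrightarrow> card (A \<inter> B) \<le> rank M A"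
  unfolding rank_def using finite_bases by simp

lemma ex_basis_rank: "\<exists>B\<in>bases M. card (A \<inter> B) = rank M A"
proof -
  have "rank M A \<in> (\<lambda>B. card (A \<inter> B)) ` bases M"
    unfolding rank_def using finite_bases ex_basis by (intro Max_in) auto
  then show ?thesis by force
qed

lemma card_bases_eq:
  assumes "A \<in> bases M" "B \<in> bases M"
  shows "card A = card B"
  using assms
proof (induction "card (A - B)" arbitrary: A rule: less_induct)
  case less
  note fin = finite_basis[OF less.prems(1)] finite_basis[OF less.prems(2)]
  show ?case
  proof (cases "A \<subseteq> B")
    case True
    have "B \<subseteq> A"
      using basis_exchange[OF less.prems(2,1)] True by blast
    with True show ?thesis by simp
  next
    case False
    then obtain x where x: "x \<in> A - B" by blast
    then obtain y where y: "y \<in> B - A" "insert y (A - {x}) \<in> bases M"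
      using basis_exchange less.prems by blast
    have "insert y (A - {x}) - B = (A - B) - {x}" using x y by auto
    then have "card (insert y (A - {x}) - B) < card (A - B)"
      using x fin by (metis card_Diff1_less finite_Diff)
    from less.hyps[OF this y(2) less.prems(2)] show ?thesis
      using x y fin by (metis DiffE Diff_empty card_Diff_insert card_Suc_Diff1
          card_insert_disjoint empty_iff finite_Diff insert_Diff_if insert_iff)
  qed
qed

lemma ex_basis_exchange_into:
  assumes "B \<in> bases M" "card (G \<inter> B) < rank M G"
  shows "\<exists>x\<in>B - G. \<exists>y\<in>G - B. insert y (B - {x}) \<in> bases M"
proof -
  define S where "S = {C \<in> bases M. card (G \<inter> C) = rank M G}"
  have "finite S" "S \<noteq> {}"
    using finite_bases ex_basis_rank[of G] by (auto simp: S_def)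
  then obtain C where C: "C \<in> S" and max: "\<And>D. D \<in> S \<Longrightarrow> card (D \<inter> B) \<le> card (C \<inter> B)"
    using Max_in[of "(\<lambda>D. card (D \<inter> B)) ` S"] Max_ge[of "(\<lambda>D. card (D \<inter> B)) ` S"]
    by (smt (verit) finite_imageI image_iff image_is_empty)
  have Cb: "C \<in> bases M" "card (G \<inter> C) = rank M G" using C by (auto simp: S_def)
  note fin = finite_basis[OF assms(1)] finite_basis[OF Cb(1)]
  have sub: "C - B \<subseteq> G"
  proof (rule ccontr)
    assume "\<not> C - B \<subseteq> G"
    then obtain x where x: "x \<in> C - B" "x \<notin> G" by blast
    then obtain y where y: "y \<in> B - C" "insert y (C - {x}) \<in> bases M"
      using basis_exchange Cb assms by blast
    let ?D = "insert y (C - {x})"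
    have "card (G \<inter> C) \<le> card (G \<inter> ?D)" using x y fin by (intro card_mono) auto
    with card_inter_le_rank[OF y(2), of G] Cb(2) have "?D \<in> S" using y by (simp add: S_def)
    from max[OF this] have "card (?D \<inter> B) \<le> card (C \<inter> B)" .
    moreover have "?D \<inter> B = insert y (C \<inter> B)" using x y by auto
    ultimately show False using y fin by simp
  qed
  have "\<not> B - C \<subseteq> G"
  proof
    assume "B - C \<subseteq> G"
    with sub have eqs: "G \<inter> B - C = B - C" "G \<inter> C - B = C - B" "G \<inter> C \<inter> B = G \<inter> B \<inter> C"
      by blast+
    have "card (B - C) = card (C - B)"
      using card_bases_eq[OF assms(1) Cb(1)] fin
      by (metis card_le_sym_Diff le_antisym le_refl)
    moreover have "card (G \<inter> B) = card (G \<inter> B \<inter> C) + card (G \<inter> B - C)"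
      using fin by (intro card_Int_Diff) simp
    moreover have "card (G \<inter> C) = card (G \<inter> C \<inter> B) + card (G \<inter> C - B)"
      using fin by (intro card_Int_Diff) simp
    ultimately show False using assms(2) Cb(2) unfolding eqs by linarith
  qed
  then obtain x where x: "x \<in> B - C" "x \<notin> G" by blast
  then obtain y where "y \<in> C - B" "insert y (B - {x}) \<in> bases M"
    using basis_exchange Cb assms by blast
  with sub x show ?thesis by blast
qed

lemma bases_initial_matroid_chain:
  fixes c :: "'a set \<Rightarrow> real"
  assumes chain: "subset.chain (Pow (ground M)) \<G>" and pos: "\<And>G. G \<in> \<G> \<Longrightarrow> c G > 0"
  shows "bases (initial_matroid M (\<lambda>e. \<Sum>G\<in>\<G>. c G * indicator G e)) =
    {B \<in> bases M. \<forall>G\<in>\<G>. card (G \<inter> B) = rank M G}"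
    (is "bases (initial_matroid M ?w) = ?R")
proof -
  have "\<G> \<subseteq> Pow (ground M)"
    using chain unfolding subset_chain_def by blast
  then have fin\<G>: "finite \<G>"
    by (rule finite_subset) (simp add: finite_ground)
  have weight: "sum ?w B = (\<Sum>G\<in>\<G>. c G * card (G \<inter> B))" if "B \<in> bases M" for B
  proof -
    have "sum ?w B = (\<Sum>G\<in>\<G>. \<Sum>e\<in>B. c G * indicator G e)" by (rule sum.swap)
    also have "\<dots> = (\<Sum>G\<in>\<G>. c G * card (G \<inter> B))"
    proof (rule sum.cong[OF refl])
      fix G
      have "(\<Sum>e\<in>B. indicator G e :: real) = (\<Sum>e\<in>B \<inter> G. 1)"
        using finite_basis[OF that] by (simp add: indicator_def sum.inter_restrict)
      then show "(\<Sum>e\<in>B. c G * indicator G e) = c G * card (G \<inter> B)"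
        by (simp add: Int_commute flip: sum_distrib_left)
    qed
    finally show ?thesis .
  qed
  have rank_if_max: "card (G \<inter> B) = rank M G"
    if B: "B \<in> bases M" and max: "\<forall>B'\<in>bases M. sum ?w B' \<le> sum ?w B" and G: "G \<in> \<G>" for B G
  proof (rule ccontr)
    assume "card (G \<inter> B) \<noteq> rank M G"
    with card_inter_le_rank[OF B, of G] have "card (G \<inter> B) < rank M G" by simp
    then obtain x y where x: "x \<in> B - G" and y: "y \<in> G - B"
      and D: "insert y (B - {x}) \<in> bases M"
      using ex_basis_exchange_into[OF B] by blast
    let ?D = "insert y (B - {x})"
    have le: "card (H \<inter> B) \<le> card (H \<inter> ?D)" if "H \<in> \<G>" for H
    proof -
      have "H \<subseteq> G \<or> G \<subseteq> H" using chain G that unfolding subset_chain_def by blast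
      then consider "H \<subseteq> G" | "G \<subseteq> H" by blast
      then show ?thesis
      proof cases
        case 1
        then show ?thesis using x finite_basis[OF D] by (intro card_mono) auto
      next
        case 2
        then have "H \<inter> ?D = insert y (H \<inter> B - {x})" using y by auto
        moreover have "y \<notin> H \<inter> B - {x}" using y by blast
        ultimately have "card (H \<inter> ?D) = Suc (card (H \<inter> B - {x}))"
          using finite_basis[OF B] by simp
        moreover have "card (H \<inter> B) - 1 \<le> card (H \<inter> B - {x})"
          using diff_card_le_card_Diff[of "{x}" "H \<inter> B"] by simp
        ultimately show ?thesis by linarith
      qed
    qed
    have "G \<inter> ?D = insert y (G \<inter> B)" using x y by auto
    then have less: "card (G \<inter> B) < card (G \<inter> ?D)" using y finite_basis[OF B] by simp
    have "sum ?w B < sum ?w ?D"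
      unfolding weight[OF B] weight[OF D]
    proof (intro sum_strict_mono_ex1 ballI)
      show "c H * card (H \<inter> B) \<le> c H * card (H \<inter> ?D)" if "H \<in> \<G>" for H
        using le[OF that] pos[OF that] by simp
      show "\<exists>H\<in>\<G>. c H * card (H \<inter> B) < c H * card (H \<inter> ?D)"
        using less G pos[OF G] by (intro bexI[of _ G]) simp_all
    qed (fact fin\<G>)
    with max D show False by force
  qed
  have max_if_rank: "sum ?w B' \<le> sum ?w B"
    if "B \<in> ?R" "B' \<in> bases M" for B B'
  proof -
    from that have B: "B \<in> bases M" by simp
    show ?thesis
      unfolding weight[OF B] weight[OF that(2)]
    proof (rule sum_mono)
      fix G assume "G \<in> \<G>"
      with that show "c G * card (G \<inter> B') \<le> c G * card (G \<inter> B)"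
        using pos[of G] card_inter_le_rank[of B' G] by simp
    qed
  qed
  show ?thesis
    unfolding initial_matroid_def using rank_if_max max_if_rank by simp blast
qed

lemma flag_matroid_eq:
  fixes c :: "'a set \<Rightarrow> real"
  assumes "\<G> \<in> flags M" and "\<And>G. G \<in> \<G> \<Longrightarrow> c G > 0"
  shows "initial_matroid M (\<lambda>e. \<Sum>G\<in>\<G>. c G * indicator G e) = flag_matroid M \<G>"
proof -
  have "subset.chain (Pow (ground M)) \<G>"
    using assms(1) unfolding flags_def flats_def subset_chain_def by blast
  then show ?thesis
    using bases_initial_matroid_chain[of \<G> c] bases_initial_matroid_chain[of \<G> "\<lambda>_. 1"] assms(2)
    by (simp add: flag_matroid_def initial_matroid_def)
qed

end


section \<open>Poincare polynomials\<close>

definition poincare_fract :: "'a matroid_data \<Rightarrow> 'a set set \<Rightarrow> int poly fract" where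
  "poincare_fract M \<F> =
    (\<Sum>\<G>\<in>{\<G> \<in> proper_flags M. \<F> \<subseteq> \<G>}. reduced_char_poly (flag_matroid M \<G>) / (q - 1) ^ card \<G>)"

text \<open>
  The fraction above as an element of \<open>\<int>[q]\<close>; \<open>to_fract\<close> is injective, so there is at most one
  such polynomial.  For a loopless matroid on the empty set the fraction is \<open>1 / (q - 1)\<close>, and
  the value is unspecified.
\<close>

definition poincare_poly :: "'a matroid_data \<Rightarrow> 'a set set \<Rightarrow> int poly" where
  "poincare_poly M \<F> = (THE p. to_fract p = poincare_fract M \<F>)"

definition eval_int_poly :: "int poly \<Rightarrow> int poly fract \<Rightarrow> int poly fract" where
  "eval_int_poly p x = poly (map_poly of_int p) x"

end

theory Submission
  imports Defs
begin

text \<open>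
  For flats \<open>X \<subset> Y\<close> let \<open>\<kappa>(X, Y)\<close> be the reduced characteristic polynomial of the interval
  \<open>[X, Y]\<close>.  Since \<open>M\<^sub>\<G>\<close> has rank function \<open>A \<mapsto> \<Sum>\<^sub>G (r((A \<inter> G) \<union> z(G)) - r(z(G)))\<close>,
  Whitney's rank expansion factors its characteristic polynomial over the intervals
  \<open>[z(G), G]\<close>.  Hence the Poincare polynomial is the sum, over the chains \<open>\<G>\<close> refining \<open>\<F>\<close>, of
  the products of the \<open>\<kappa>(z(G), G)\<close>, and it is a product of such sums with empty \<open>\<F>\<close>.  For
  these sums \<open>h(X, Y)\<close> one has \<open>h = \<kappa> + \<Sum>\<^sub>Z h(X, Z) \<kappa>(Z, Y)\<close>.  In the incidence algebra the
  characteristic polynomial is inverse to its reversal, that is,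
  \<open>q \<kappa> = \<kappa>' + (q - 1) \<Sum>\<^sub>Z \<kappa>(X, Z) \<kappa>'(Z, Y)\<close> with \<open>\<kappa>'(X, Y)(q) = q\<^bsup>r(Y) - r(X)\<^esup> \<kappa>(X, Y)(1/q)\<close>.
  Substituting this for \<open>\<kappa>\<close> in the recursion for \<open>h\<close> gives, by induction on \<open>Y\<close>,
  \<open>q h(X, Y)(q) = q\<^bsup>r(Y) - r(X)\<^esup> h(X, Y)(1/q)\<close>.
\<close>

section \<open>Moebius inversion\<close>

text \<open>By transitivity both sides range over the pairs \<open>Z\<close>, \<open>W\<close> with
  \<open>X\<close>, \<open>Z\<close>, \<open>W\<close>, \<open>Y\<close> successively related.
  \<open>R\<close> is left open because both \<open>\<subseteq>\<close> and \<open>\<subset>\<close>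
  occur below.\<close>

lemma sum_interval_swap:
  assumes "finite L" "transp R"
  shows "(\<Sum>Z\<in>{Z\<in>L. R X Z \<and> R Z Y}. \<Sum>W\<in>{W\<in>L. R Z W \<and> R W Y}. f Z W) =
    (\<Sum>W\<in>{W\<in>L. R X W \<and> R W Y}. \<Sum>Z\<in>{Z\<in>L. R X Z \<and> R Z W}. f Z W)"
proof -
  let ?I = "{Z\<in>L. R X Z \<and> R Z Y}"
  have "(\<Sum>Z\<in>?I. \<Sum>W\<in>{W\<in>L. R Z W \<and> R W Y}. f Z W) = (\<Sum>Z\<in>?I. \<Sum>W\<in>{W\<in>?I. R Z W}. f Z W)"
    using transpD[OF assms(2)] by (intro sum.cong) blast+
  also have "\<dots> = (\<Sum>W\<in>?I. \<Sum>Z\<in>{Z\<in>?I. R Z W}. f Z W)"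
    using assms(1) by (intro sum.swap_restrict) auto
  also have "\<dots> = (\<Sum>W\<in>?I. \<Sum>Z\<in>{Z\<in>L. R X Z \<and> R Z W}. f Z W)"
    using transpD[OF assms(2)] by (intro sum.cong) blast+
  finally show ?thesis .
qed

text \<open>Zeta is cancellable in the incidence algebra: once the values below \<open>Y\<close>
  agree, the equal sums leave equal top terms.\<close>

lemma interval_sums_determine:
  fixes f g :: "'a set \<Rightarrow> 'b::ab_group_add"
  assumes "finite L" and fin: "\<And>Z. Z \<in> L \<Longrightarrow> finite Z"
    and sums: "\<And>Y. Y \<in> L \<Longrightarrow> X \<subseteq> Y \<Longrightarrow> (\<Sum>Z\<in>{Z\<in>L. X \<subseteq> Z \<and> Z \<subseteq> Y}. f Z) = (\<Sum>Z\<in>{Z\<in>L. X \<subseteq> Z \<and> Z \<subseteq> Y}. g Z)"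
    and "Y \<in> L" "X \<subseteq> Y"
  shows "f Y = g Y"
  using assms(4,5)
proof (induction "card Y" arbitrary: Y rule: less_induct)
  case less
  let ?I = "{Z\<in>L. X \<subseteq> Z \<and> Z \<subset> Y}"
  have split: "{Z\<in>L. X \<subseteq> Z \<and> Z \<subseteq> Y} = insert Y ?I" using less.prems by auto
  have "sum f ?I = sum g ?I"
    using less fin by (intro sum.cong) (auto intro: psubset_card_mono)
  with sums[OF less.prems] show ?case
    using \<open>finite L\<close> unfolding split by simp
qed

lemma sum_moebius_right:
  assumes "finite L" "X \<in> L" "Y \<in> L" "X \<subseteq> Y" "finite Y"
  shows "(\<Sum>Z\<in>{Z\<in>L. X \<subseteq> Z \<and> Z \<subseteq> Y}. moebius L X Z) = (if X = Y then 1 else 0)"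
proof (cases "X = Y")
  case True
  then have "{Z\<in>L. X \<subseteq> Z \<and> Z \<subseteq> Y} = {Y}" using assms by auto
  with True show ?thesis by (simp add: moebius.simps)
next
  case False
  have "{Z\<in>L. X \<subseteq> Z \<and> Z \<subseteq> Y} = insert Y {Z\<in>L. X \<subseteq> Z \<and> Z \<subset> Y}" using assms by auto
  with False assms show ?thesis by (simp add: moebius.simps[of L X Y] psubset_eq)
qed

text \<open>The recursion for \<open>moebius\<close> says \<mu>\<zeta> = 1; this is \<zeta>\<mu> =
  1. Associativity gives (\<zeta>\<mu>)\<zeta> = \<zeta>, and \<zeta> cancels on the right.\<close>

lemma sum_moebius_left:
  assumes "finite L" and fin: "\<And>Z. Z \<in> L \<Longrightarrow> finite Z" and "X \<in> L" "Y \<in> L" "X \<subseteq> Y"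
  shows "(\<Sum>Z\<in>{Z\<in>L. X \<subseteq> Z \<and> Z \<subseteq> Y}. moebius L Z Y) = (if X = Y then 1 else 0)"
proof (rule interval_sums_determine[where L = L and X = X])
  fix Y assume Y: "Y \<in> L" "X \<subseteq> Y"
  have "(\<Sum>W\<in>{W\<in>L. X \<subseteq> W \<and> W \<subseteq> Y}. \<Sum>Z\<in>{Z\<in>L. X \<subseteq> Z \<and> Z \<subseteq> W}. moebius L Z W) =
      (\<Sum>Z\<in>{Z\<in>L. X \<subseteq> Z \<and> Z \<subseteq> Y}. \<Sum>W\<in>{W\<in>L. Z \<subseteq> W \<and> W \<subseteq> Y}. moebius L Z W)"
    using \<open>finite L\<close> by (intro sum_interval_swap[symmetric]) auto
  also have "\<dots> = (\<Sum>Z\<in>{Z\<in>L. X \<subseteq> Z \<and> Z \<subseteq> Y}. if Z = Y then 1 else 0)"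
    using Y assms by (intro sum.cong refl sum_moebius_right) auto
  also have "\<dots> = 1" using Y \<open>finite L\<close> by simp
  also have "\<dots> = (\<Sum>W\<in>{W\<in>L. X \<subseteq> W \<and> W \<subseteq> Y}. if X = W then 1 else 0)"
    using Y assms by (simp add: eq_commute[of X])
  finally show "(\<Sum>W\<in>{W\<in>L. X \<subseteq> W \<and> W \<subseteq> Y}. \<Sum>Z\<in>{Z\<in>L. X \<subseteq> Z \<and> Z \<subseteq> W}. moebius L Z W) =
      (\<Sum>W\<in>{W\<in>L. X \<subseteq> W \<and> W \<subseteq> Y}. if X = W then 1 else 0)" .
qed (use assms in auto)

section \<open>Evaluation of integer polynomials\<close>

lemma eval_int_poly_pCons [simp]:
  "eval_int_poly (pCons a p) x = of_int a + x * eval_int_poly p x"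
  by (simp add: eval_int_poly_def map_poly_pCons)

lemma eval_int_poly_0 [simp]: "eval_int_poly 0 x = 0"
  by (simp add: eval_int_poly_def)

lemma eval_int_poly_1 [simp]: "eval_int_poly 1 x = 1"
  unfolding one_pCons by simp

lemma eval_int_poly_add [simp]:
  "eval_int_poly (p + r) x = eval_int_poly p x + eval_int_poly r x"
proof (induction p arbitrary: r)
  case (pCons a p)
  show ?case by (cases r) (simp add: pCons.IH, simp add: algebra_simps)
qed simp

lemma eval_int_poly_smult [simp]: "eval_int_poly (smult a p) x = of_int a * eval_int_poly p x"
  by (induction p) (simp_all add: algebra_simps)

lemma eval_int_poly_mult [simp]:
  "eval_int_poly (p * r) x = eval_int_poly p x * eval_int_poly r x"
  by (induction p) (simp_all add: algebra_simps)

lemma eval_int_poly_sum [simp]: "eval_int_poly (sum f A) x = (\<Sum>a\<in>A. eval_int_poly (f a) x)"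
  by (induction A rule: infinite_finite_induct) simp_all

lemma eval_int_poly_monom [simp]: "eval_int_poly (monom a n) x = of_int a * x ^ n"
  by (induction n) (simp_all add: monom_0 monom_Suc)

lemma to_fract_of_int: "to_fract [:a:] = (of_int a :: int poly fract)"
proof (induction a rule: int_induct[where k = 0])
  case (step1 i)
  have "[:i + 1:] = [:i:] + (1::int poly)" by (simp add: one_pCons)
  with step1 show ?case by (simp del: add_pCons)
next
  case (step2 i)
  have "[:i - 1:] = [:i:] - (1::int poly)" by (simp add: one_pCons)
  with step2 show ?case by (simp del: diff_pCons)
qed simp

text \<open>Allows \<open>eval_int_poly p q\<close> in the theorem to be read as the polynomial
  itself inside the fraction field.\<close>

lemma eval_int_poly_q: "eval_int_poly p q = to_fract p"
proof (induction p)
  case (pCons a p)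
  have "pCons a p = [:a:] + [:0, 1:] * p" by simp
  then show ?case using pCons.IH by (simp add: to_fract_of_int q_def del: mult_pCons_left add_pCons)
qed simp

lemma to_fract_power: "to_fract (x ^ n) = to_fract x ^ n"
  by (induction n) simp_all

lemma q_neq_0: "q \<noteq> 0" and q_neq_1: "q \<noteq> 1"
  unfolding q_def to_fract_1[symmetric] to_fract_eq_iff by (simp_all add: one_pCons)

lemma prod_monom: "(\<Prod>i\<in>I. monom (c i) (n i)) = monom (\<Prod>i\<in>I. c i) (\<Sum>i\<in>I. n i)"
  by (induction I rule: infinite_finite_induct) (simp_all add: mult_monom)

section \<open>Characteristic polynomials of intervals\<close>

text \<open>For the flats of a matroid this is the characteristic polynomial of the minor
  M|Y/X.\<close>

definition interval_char_poly :: "'a set set \<Rightarrow> ('a set \<Rightarrow> nat) \<Rightarrow> 'a set \<Rightarrow> 'a set \<Rightarrow> int poly" where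
  "interval_char_poly L \<rho> X Y =
    (\<Sum>Z\<in>{Z\<in>L. X \<subseteq> Z \<and> Z \<subseteq> Y}. monom (moebius L X Z) (\<rho> Y - \<rho> Z))"

text \<open>The division is exact for \<open>X \<subset> Y\<close> by
  \<open>char_eq_reduced\<close>; staying in \<int>[q] makes the Poincare polynomial visibly a
  polynomial.\<close>

definition reduced_interval_char_poly ::
    "'a set set \<Rightarrow> ('a set \<Rightarrow> nat) \<Rightarrow> 'a set \<Rightarrow> 'a set \<Rightarrow> int poly" where
  "reduced_interval_char_poly L \<rho> X Y = interval_char_poly L \<rho> X Y div [:-1, 1:]"

text \<open>The setting of the palindromicity argument, instantiated later by the flats of a matroid
  and its rank function.\<close>

locale ranked_family =
  fixes L :: "'a set set" and \<rho> :: "'a set \<Rightarrow> nat"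
  assumes finite_family: "finite L" and finite_member: "X \<in> L \<Longrightarrow> finite X"
    and rank_mono: "X \<in> L \<Longrightarrow> Y \<in> L \<Longrightarrow> X \<subseteq> Y \<Longrightarrow> \<rho> X \<le> \<rho> Y"
begin

abbreviation "\<chi> \<equiv> interval_char_poly L \<rho>"
abbreviation "\<kappa> \<equiv> reduced_interval_char_poly L \<rho>"

lemma char_refl: "X \<in> L \<Longrightarrow> \<chi> X X = 1"
proof -
  assume "X \<in> L"
  then have "{Z\<in>L. X \<subseteq> Z \<and> Z \<subseteq> X} = {X}" by auto
  then show ?thesis
    by (simp add: interval_char_poly_def moebius.simps monom_0 one_pCons)
qed

text \<open>The value at 1 is the sum of the Moebius function over a proper interval, which
  vanishes.\<close>

lemma char_eq_reduced:
  assumes "X \<in> L" "Y \<in> L" "X \<subset> Y"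
  shows "\<chi> X Y = [:-1, 1:] * \<kappa> X Y"
proof -
  have "poly (\<chi> X Y) 1 = (\<Sum>Z\<in>{Z\<in>L. X \<subseteq> Z \<and> Z \<subseteq> Y}. moebius L X Z)"
    by (simp add: interval_char_poly_def poly_sum poly_monom)
  also have "\<dots> = 0"
    using sum_moebius_right[of L X Y] assms finite_family finite_member by auto
  finally have "[:-1, 1:] dvd \<chi> X Y" by (simp add: poly_eq_0_iff_dvd)
  then show ?thesis by (simp only: reduced_interval_char_poly_def dvd_mult_div_cancel)
qed

section \<open>Reversed polynomials and the kernel identity\<close>

definition rev_char :: "int poly fract \<Rightarrow> 'a set \<Rightarrow> 'a set \<Rightarrow> int poly fract" where
  "rev_char x X Y = x ^ (\<rho> Y - \<rho> X) * eval_int_poly (\<chi> X Y) (inverse x)"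

text \<open>Reversal turns the corank exponent \<rho> Y - \<rho> Z into the rank exponent \<rho> Z -
  \<rho> X; monotonicity makes the natural subtractions exact.\<close>

lemma rev_char_eq_sum:
  assumes "X \<in> L" "Y \<in> L" "x \<noteq> 0"
  shows "rev_char x X Y =
    (\<Sum>Z\<in>{Z\<in>L. X \<subseteq> Z \<and> Z \<subseteq> Y}. of_int (moebius L X Z) * x ^ (\<rho> Z - \<rho> X))"
proof -
  have "x ^ (\<rho> Y - \<rho> X) * inverse x ^ (\<rho> Y - \<rho> Z) = x ^ (\<rho> Z - \<rho> X)"
    if "Z \<in> L" "X \<subseteq> Z" "Z \<subseteq> Y" for Z
  proof -
    have "\<rho> Y - \<rho> X = (\<rho> Z - \<rho> X) + (\<rho> Y - \<rho> Z)"
      using rank_mono[of X Z] rank_mono[of Z Y] that assms by simp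
    then show ?thesis using assms(3) by (simp add: power_add power_inverse)
  qed
  then show ?thesis
    unfolding rev_char_def interval_char_poly_def
    by (auto simp: sum_distrib_left mult.left_commute intro!: sum.cong)
qed

text \<open>
  In the incidence algebra, \<open>\<chi> = \<mu> * \<zeta>\<^sup>r\<^sup>e\<^sup>v\<close> and hence \<open>\<chi>\<^sup>r\<^sup>e\<^sup>v = \<mu>\<^sup>r\<^sup>e\<^sup>v * \<zeta>\<close>, where \<open>\<zeta>\<^sup>r\<^sup>e\<^sup>v\<close> and \<open>\<mu>\<^sup>r\<^sup>e\<^sup>v\<close>
  are mutually inverse.
\<close>

lemma char_kernel:
  assumes X: "X \<in> L" and Y: "Y \<in> L" and "X \<subseteq> Y" and "x \<noteq> 0"
  shows "(\<Sum>Z\<in>{Z\<in>L. X \<subseteq> Z \<and> Z \<subseteq> Y}. eval_int_poly (\<chi> X Z) x * rev_char x Z Y) =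
    (if X = Y then 1 else 0)"
proof -
  let ?m = "\<lambda>U V. of_int (moebius L U V) :: int poly fract"
  have "(\<Sum>Z\<in>{Z\<in>L. X \<subseteq> Z \<and> Z \<subseteq> Y}. eval_int_poly (\<chi> X Z) x * rev_char x Z Y) =
    (\<Sum>Z\<in>{Z\<in>L. X \<subseteq> Z \<and> Z \<subseteq> Y}. \<Sum>W\<in>{W\<in>L. Z \<subseteq> W \<and> W \<subseteq> Y}. \<Sum>V\<in>{V\<in>L. X \<subseteq> V \<and> V \<subseteq> Z}.
      ?m X V * x ^ (\<rho> W - \<rho> V) * ?m Z W)"
  proof (rule sum.cong[OF refl])
    fix Z assume Z: "Z \<in> {Z\<in>L. X \<subseteq> Z \<and> Z \<subseteq> Y}"
    \<comment> \<open>The powers of \<open>x\<close> telescope, so \<open>Z\<close> survives only in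
      \<open>?m Z W\<close>.\<close>
    have *: "?m X V * x ^ (\<rho> Z - \<rho> V) * (?m Z W * x ^ (\<rho> W - \<rho> Z)) = ?m X V * x ^ (\<rho> W - \<rho> V) * ?m Z W"
      if "V \<in> L" "V \<subseteq> Z" "W \<in> L" "Z \<subseteq> W" for V W
    proof -
      have "\<rho> W - \<rho> V = (\<rho> Z - \<rho> V) + (\<rho> W - \<rho> Z)"
        using that Z rank_mono[of V Z] rank_mono[of Z W] by simp
      then show ?thesis by (simp add: power_add)
    qed
    have "eval_int_poly (\<chi> X Z) x * rev_char x Z Y =
      (\<Sum>V\<in>{V\<in>L. X \<subseteq> V \<and> V \<subseteq> Z}. \<Sum>W\<in>{W\<in>L. Z \<subseteq> W \<and> W \<subseteq> Y}.
        ?m X V * x ^ (\<rho> Z - \<rho> V) * (?m Z W * x ^ (\<rho> W - \<rho> Z)))"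
      using Z assms by (subst rev_char_eq_sum) (auto simp: interval_char_poly_def sum_product)
    also have "\<dots> = (\<Sum>V\<in>{V\<in>L. X \<subseteq> V \<and> V \<subseteq> Z}. \<Sum>W\<in>{W\<in>L. Z \<subseteq> W \<and> W \<subseteq> Y}.
        ?m X V * x ^ (\<rho> W - \<rho> V) * ?m Z W)"
      using * by (intro sum.cong refl) blast
    finally show "eval_int_poly (\<chi> X Z) x * rev_char x Z Y =
      (\<Sum>W\<in>{W\<in>L. Z \<subseteq> W \<and> W \<subseteq> Y}. \<Sum>V\<in>{V\<in>L. X \<subseteq> V \<and> V \<subseteq> Z}. ?m X V * x ^ (\<rho> W - \<rho> V) * ?m Z W)"
      by (subst sum.swap) simp
  qed
  \<comment> \<open>Two exchanges make \<open>Z\<close> the innermost index, running from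
    \<open>V\<close> to \<open>W\<close>; the sum of \<open>moebius L Z W\<close> over it then
    forces \<open>V = W\<close>.\<close>
  also have "\<dots> = (\<Sum>W\<in>{W\<in>L. X \<subseteq> W \<and> W \<subseteq> Y}. \<Sum>Z\<in>{Z\<in>L. X \<subseteq> Z \<and> Z \<subseteq> W}. \<Sum>V\<in>{V\<in>L. X \<subseteq> V \<and> V \<subseteq> Z}.
      ?m X V * x ^ (\<rho> W - \<rho> V) * ?m Z W)"
    using finite_family by (intro sum_interval_swap) auto
  also have "\<dots> = (\<Sum>W\<in>{W\<in>L. X \<subseteq> W \<and> W \<subseteq> Y}. \<Sum>V\<in>{V\<in>L. X \<subseteq> V \<and> V \<subseteq> W}. \<Sum>Z\<in>{Z\<in>L. V \<subseteq> Z \<and> Z \<subseteq> W}.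
      ?m X V * x ^ (\<rho> W - \<rho> V) * ?m Z W)"
    using finite_family by (intro sum.cong refl sum_interval_swap[symmetric]) auto
  also have "\<dots> = (\<Sum>W\<in>{W\<in>L. X \<subseteq> W \<and> W \<subseteq> Y}. \<Sum>V\<in>{V\<in>L. X \<subseteq> V \<and> V \<subseteq> W}. if V = W then ?m X W else 0)"
  proof (intro sum.cong refl)
    fix W V assume "W \<in> {W\<in>L. X \<subseteq> W \<and> W \<subseteq> Y}" "V \<in> {V\<in>L. X \<subseteq> V \<and> V \<subseteq> W}"
    then have "(\<Sum>Z\<in>{Z\<in>L. V \<subseteq> Z \<and> Z \<subseteq> W}. moebius L Z W) = (if V = W then 1 else 0)"
      using finite_family finite_member by (intro sum_moebius_left) auto
    then show "(\<Sum>Z\<in>{Z\<in>L. V \<subseteq> Z \<and> Z \<subseteq> W}. ?m X V * x ^ (\<rho> W - \<rho> V) * ?m Z W) = (if V = W then ?m X W else 0)"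
      by (simp flip: sum_distrib_left of_int_sum)
  qed
  also have "\<dots> = (\<Sum>W\<in>{W\<in>L. X \<subseteq> W \<and> W \<subseteq> Y}. ?m X W)"
    using finite_family by (intro sum.cong refl) simp
  also have "\<dots> = (if X = Y then 1 else 0)"
    using sum_moebius_right[of L X Y] assms finite_family finite_member by (simp flip: of_int_sum)
  finally show ?thesis .
qed

text \<open>For flats the exponent is one more than the degree of \<open>\<kappa> X Y\<close>, so
  this is \<open>x\<close> times the usual reversal; it matches the factor \<open>x\<close> in the
  identities below.\<close>

definition rev_reduced :: "int poly fract \<Rightarrow> 'a set \<Rightarrow> 'a set \<Rightarrow> int poly fract" where
  "rev_reduced x X Y = x ^ (\<rho> Y - \<rho> X) * eval_int_poly (\<kappa> X Y) (inverse x)"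

text \<open>In \<open>char_kernel\<close> the ends \<open>Z = X\<close> and \<open>Z = Y\<close> are
  split off, each \<open>\<chi>\<close> of a proper interval is written as x - 1 times
  \<open>\<kappa>\<close>, its reversal as 1/x - 1 times that of \<open>\<kappa>\<close>, and x - 1
  is cancelled.\<close>

lemma reduced_kernel:
  assumes X: "X \<in> L" and Y: "Y \<in> L" and "X \<subset> Y" and x: "x \<noteq> 0" "x \<noteq> 1"
  shows "x * eval_int_poly (\<kappa> X Y) x = rev_reduced x X Y +
    (x - 1) * (\<Sum>Z\<in>{Z\<in>L. X \<subset> Z \<and> Z \<subset> Y}. eval_int_poly (\<kappa> X Z) x * rev_reduced x Z Y)"
proof -
  let ?k = "\<lambda>U V. eval_int_poly (\<kappa> U V) x"
  let ?I = "{Z\<in>L. X \<subset> Z \<and> Z \<subset> Y}"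
  have c: "eval_int_poly (\<chi> U V) x = (x - 1) * ?k U V" if "U \<in> L" "V \<in> L" "U \<subset> V" for U V
    using that by (simp add: char_eq_reduced del: mult_pCons_left)
  have r: "rev_char x U V = (inverse x - 1) * rev_reduced x U V" if "U \<in> L" "V \<in> L" "U \<subset> V" for U V
    using that by (simp add: rev_char_def rev_reduced_def char_eq_reduced del: mult_pCons_left)
  have r1: "rev_char x U U = 1" if "U \<in> L" for U
    using that by (simp add: rev_char_def char_refl)
  have I: "{Z\<in>L. X \<subseteq> Z \<and> Z \<subseteq> Y} = insert X (insert Y ?I)" using assms by auto
  have "X \<noteq> Y" "X \<subseteq> Y" using assms by auto
  then have "0 = (\<Sum>Z\<in>insert X (insert Y ?I). eval_int_poly (\<chi> X Z) x * rev_char x Z Y)"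
    using char_kernel[OF X Y _ x(1)] unfolding I by simp
  also have "\<dots> = eval_int_poly (\<chi> X X) x * rev_char x X Y + (eval_int_poly (\<chi> X Y) x * rev_char x Y Y +
      (\<Sum>Z\<in>?I. eval_int_poly (\<chi> X Z) x * rev_char x Z Y))"
    using \<open>X \<noteq> Y\<close> finite_family by (subst sum.insert, simp, simp)+ simp
  finally have "0 = rev_char x X Y + eval_int_poly (\<chi> X Y) x + (\<Sum>Z\<in>?I. eval_int_poly (\<chi> X Z) x * rev_char x Z Y)"
    by (simp add: char_refl[OF X] r1[OF Y] add.assoc)
  also have "(\<Sum>Z\<in>?I. eval_int_poly (\<chi> X Z) x * rev_char x Z Y) =
      (x - 1) * (inverse x - 1) * (\<Sum>Z\<in>?I. ?k X Z * rev_reduced x Z Y)"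
    unfolding sum_distrib_left using X Y by (intro sum.cong refl) (simp add: c r mult_ac)
  finally have "0 = (inverse x - 1) * rev_reduced x X Y + (x - 1) * ?k X Y +
      (x - 1) * (inverse x - 1) * (\<Sum>Z\<in>?I. ?k X Z * rev_reduced x Z Y)"
    unfolding c[OF X Y \<open>X \<subset> Y\<close>] r[OF X Y \<open>X \<subset> Y\<close>] .
  moreover have "inverse x - 1 = - (x - 1) * inverse x" using x by (simp add: algebra_simps)
  ultimately have "0 = (x - 1) * (?k X Y - inverse x * (rev_reduced x X Y + (x - 1) * (\<Sum>Z\<in>?I. ?k X Z * rev_reduced x Z Y)))"
    by (simp add: algebra_simps)
  then have "?k X Y = inverse x * (rev_reduced x X Y + (x - 1) * (\<Sum>Z\<in>?I. ?k X Z * rev_reduced x Z Y))"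
    using x by simp
  then show ?thesis by (simp only: mult.assoc[symmetric] right_inverse[OF x(1)] mult_1_left)
qed

end

section \<open>Sums over chains\<close>

text \<open>For a loopless matroid, \<open>X = {}\<close> and \<open>Y = ground M\<close> give the
  proper flags.\<close>

definition chains_between :: "'a set set \<Rightarrow> 'a set \<Rightarrow> 'a set \<Rightarrow> 'a set set set" where
  "chains_between L X Y = {\<G>. subset.chain {Z\<in>L. X \<subset> Z \<and> Z \<subset> Y} \<G>}"

text \<open>The largest member of the chain \<open>\<G>\<close> strictly below \<open>G\<close>, or \<open>X\<close> if there is none.\<close>

definition chain_pred :: "'a set \<Rightarrow> 'a set set \<Rightarrow> 'a set \<Rightarrow> 'a set" where
  "chain_pred X \<G> G = X \<union> \<Union>{H\<in>\<G>. H \<subset> G}"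

text \<open>For a chain X \<subset> G1 \<subset> ... \<subset> Gk \<subset> Y this is the product of
  f X G1, f G1 G2, ..., f Gk Y. The k + 1 factors account for the \<open>Suc\<close> in later
  exponents.\<close>

definition chain_weight ::
    "('a set \<Rightarrow> 'a set \<Rightarrow> 'b::comm_semiring_1) \<Rightarrow> 'a set \<Rightarrow> 'a set \<Rightarrow> 'a set set \<Rightarrow> 'b" where
  "chain_weight f X Y \<G> = (\<Prod>G\<in>insert Y \<G>. f (chain_pred X \<G> G) G)"

text \<open>With \<open>\<kappa>\<close> for \<open>f\<close>, \<open>X = {}\<close> and
  \<open>Y = ground M\<close> this turns out to be the Poincare polynomial at
  \<open>\<F>\<close>.\<close>

definition chain_sum ::
    "'a set set \<Rightarrow> ('a set \<Rightarrow> 'a set \<Rightarrow> 'b::comm_semiring_1) \<Rightarrow> 'a set set \<Rightarrow> 'a set \<Rightarrow> 'a set \<Rightarrow> 'b" where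
  "chain_sum L f \<F> X Y = (\<Sum>\<G>\<in>{\<G>\<in>chains_between L X Y. \<F> \<subseteq> \<G>}. chain_weight f X Y \<G>)"

lemma chains_between_iff:
  "\<G> \<in> chains_between L X Y \<longleftrightarrow>
    \<G> \<subseteq> {Z\<in>L. X \<subset> Z \<and> Z \<subset> Y} \<and> (\<forall>G\<in>\<G>. \<forall>H\<in>\<G>. G \<subseteq> H \<or> H \<subseteq> G)"
  by (auto simp: chains_between_def subset_chain_def)

lemma finite_chains_between: "finite L \<Longrightarrow> finite (chains_between L X Y)"
  by (rule finite_subset[of _ "Pow L"]) (auto simp: chains_between_iff)

lemma finite_chain: "finite L \<Longrightarrow> \<G> \<in> chains_between L X Y \<Longrightarrow> finite \<G>"
  by (rule finite_subset[of _ L]) (auto simp: chains_between_iff)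

lemma empty_chain: "{} \<in> chains_between L X Y"
  by (simp add: chains_between_iff)

text \<open>Lets \<open>\<Union>\<G>\<close> serve as the maximum of a nonempty chain.\<close>

lemma Union_chain_mem:
  assumes "finite L" "\<G> \<in> chains_between L X Y" "\<G> \<noteq> {}"
  shows "\<Union>\<G> \<in> \<G>"
  using Union_in_chain[OF finite_chain] assms unfolding chains_between_def by blast

section \<open>Cutting and extending chains\<close>

context
  fixes L :: "'a set set" and X T Y :: "'a set"
  assumes fin: "finite L" and T: "T \<in> L" "X \<subset> T" "T \<subset> Y"
begin

lemma chain_join:
  assumes "\<G>1 \<in> chains_between L X T" "\<G>2 \<in> chains_between L T Y"
  shows "\<G>1 \<union> insert T \<G>2 \<in> chains_between L X Y"
proof -
  have 1: "\<forall>G\<in>\<G>1. G \<in> L \<and> X \<subset> G \<and> G \<subset> T" "\<forall>G\<in>\<G>1. \<forall>H\<in>\<G>1. G \<subseteq> H \<or> H \<subseteq> G"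
    using assms(1) by (auto simp: chains_between_iff)
  have 2: "\<forall>G\<in>\<G>2. G \<in> L \<and> T \<subset> G \<and> G \<subset> Y" "\<forall>G\<in>\<G>2. \<forall>H\<in>\<G>2. G \<subseteq> H \<or> H \<subseteq> G"
    using assms(2) by (auto simp: chains_between_iff)
  have "G \<in> L \<and> X \<subset> G \<and> G \<subset> Y" if "G \<in> \<G>1 \<union> insert T \<G>2" for G
    using that 1(1) 2(1) T by (elim UnE insertE) blast+
  moreover have "G \<subseteq> H \<or> H \<subseteq> G" if "G \<in> \<G>1 \<union> insert T \<G>2" "H \<in> \<G>1 \<union> insert T \<G>2" for G H
  proof -
    have A: "G \<subseteq> H" if "G \<in> \<G>1" "H \<in> insert T \<G>2" for G H
    proof -
      have "G \<subseteq> T" "T \<subseteq> H" using 1(1) 2(1) that by auto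
      then show ?thesis by simp
    qed
    have B: "G \<subseteq> H \<or> H \<subseteq> G" if "G \<in> insert T \<G>2" "H \<in> insert T \<G>2" for G H
      using 2 that by auto
    show ?thesis
      using that A[of G H] A[of H G] B[of G H] 1(2) by (cases "G \<in> \<G>1"; cases "H \<in> \<G>1") simp_all
  qed
  ultimately show ?thesis unfolding chains_between_iff by simp blast
qed

text \<open>Up to \<open>T\<close> a predecessor is formed from \<open>\<G>1\<close> alone; above
  \<open>T\<close> the union contains \<open>T\<close>, which absorbs \<open>X\<close> and all of
  \<open>\<G>1\<close>.\<close>

lemma chain_weight_join:
  assumes \<G>: "\<G>1 \<in> chains_between L X T" "\<G>2 \<in> chains_between L T Y"
  shows "chain_weight f X Y (\<G>1 \<union> insert T \<G>2) = chain_weight f X T \<G>1 * chain_weight f T Y \<G>2"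
proof -
  let ?\<G> = "\<G>1 \<union> insert T \<G>2"
  have below: "G \<subset> T" if "G \<in> \<G>1" for G using \<G> that by (auto simp: chains_between_iff)
  have above: "T \<subset> G" if "G \<in> insert Y \<G>2" for G using \<G> T that by (auto simp: chains_between_iff)
  have "chain_weight f X Y ?\<G> = (\<Prod>G\<in>insert T \<G>1 \<union> insert Y \<G>2. f (chain_pred X ?\<G> G) G)"
    unfolding chain_weight_def by (rule prod.cong) auto
  also have "\<dots> = (\<Prod>G\<in>insert T \<G>1. f (chain_pred X ?\<G> G) G) * (\<Prod>G\<in>insert Y \<G>2. f (chain_pred X ?\<G> G) G)"
    using finite_chain[OF fin] \<G> below above by (intro prod.union_disjoint) blast+
  also have "(\<Prod>G\<in>insert T \<G>1. f (chain_pred X ?\<G> G) G) = chain_weight f X T \<G>1"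
    unfolding chain_weight_def
  proof (intro prod.cong refl arg_cong2[of _ _ _ _ f])
    fix G assume "G \<in> insert T \<G>1"
    then have "G \<subseteq> T" using below by blast
    then have "{H\<in>?\<G>. H \<subset> G} = {H\<in>\<G>1. H \<subset> G}" using above by blast
    then show "chain_pred X ?\<G> G = chain_pred X \<G>1 G" by (simp add: chain_pred_def)
  qed
  also have "(\<Prod>G\<in>insert Y \<G>2. f (chain_pred X ?\<G> G) G) = chain_weight f T Y \<G>2"
    unfolding chain_weight_def
  proof (intro prod.cong refl arg_cong2[of _ _ _ _ f])
    fix G assume "G \<in> insert Y \<G>2"
    then have "T \<subset> G" using above by blast
    then show "chain_pred X ?\<G> G = chain_pred T \<G>2 G"
      using below T unfolding chain_pred_def by blast
  qed
  finally show ?thesis .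
qed

text \<open>A chain through \<open>T\<close> is cut into its parts below and above \<open>T\<close>.
  All of \<open>\<F>\<close> lies below \<open>T\<close>, so the upper part is
  unconstrained.\<close>

lemma chain_sum_split:
  assumes \<F>: "\<F> \<in> chains_between L X T"
  shows "chain_sum L f (insert T \<F>) X Y = chain_sum L f \<F> X T * chain_sum L f {} T Y"
proof -
  let ?A = "{\<G>\<in>chains_between L X T. \<F> \<subseteq> \<G>}"
  let ?B = "chains_between L T Y"
  let ?C = "{\<G>\<in>chains_between L X Y. insert T \<F> \<subseteq> \<G>}"
  have sep: "G \<subset> T" if "\<G> \<in> chains_between L X T" "G \<in> \<G>" for \<G> G
    using that by (auto simp: chains_between_iff)
  have sep': "T \<subset> G" if "\<G> \<in> chains_between L T Y" "G \<in> \<G>" for \<G> G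
    using that by (auto simp: chains_between_iff)
  have "chain_sum L f \<F> X T * chain_sum L f {} T Y =
      (\<Sum>(\<G>1, \<G>2)\<in>?A \<times> ?B. chain_weight f X T \<G>1 * chain_weight f T Y \<G>2)"
    by (simp add: chain_sum_def sum_product sum.cartesian_product)
  also have "\<dots> = (\<Sum>\<G>\<in>?C. chain_weight f X Y \<G>)"
  proof -
    define i j where "i = (\<lambda>\<G>. ({G\<in>\<G>. G \<subset> T}, {G\<in>\<G>. T \<subset> G}))"
      and "j = (\<lambda>(\<G>1, \<G>2). \<G>1 \<union> insert T \<G>2)"
    show ?thesis
    proof (rule sum.reindex_bij_witness[of _ i j])
      fix p assume "p \<in> ?A \<times> ?B"
      then obtain \<G>1 \<G>2 where p: "p = (\<G>1, \<G>2)" and 1: "\<G>1 \<in> chains_between L X T" "\<F> \<subseteq> \<G>1"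
        and 2: "\<G>2 \<in> chains_between L T Y" by auto
      show "j p \<in> ?C"
        using chain_join[OF 1(1) 2] 1(2) by (auto simp: p j_def)
      show "i (j p) = p"
        using sep[OF 1(1)] sep'[OF 2] by (auto simp: p i_def j_def)
      show "chain_weight f X Y (j p) =
          (case p of (\<G>1, \<G>2) \<Rightarrow> chain_weight f X T \<G>1 * chain_weight f T Y \<G>2)"
        using chain_weight_join[OF 1(1) 2] by (simp add: p j_def)
    next
      fix \<G> assume "\<G> \<in> ?C"
      then have \<G>: "\<G> \<in> chains_between L X Y" and "T \<in> \<G>" and "\<F> \<subseteq> \<G>" by auto
      have cmp: "G \<subset> T \<or> G = T \<or> T \<subset> G" if "G \<in> \<G>" for G
        using \<G> \<open>T \<in> \<G>\<close> that unfolding chains_between_iff by blast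
      show "i \<G> \<in> ?A \<times> ?B"
        using \<G> \<open>\<F> \<subseteq> \<G>\<close> sep[OF \<F>] by (auto simp: chains_between_iff i_def)
      show "j (i \<G>) = \<G>"
        using cmp \<open>T \<in> \<G>\<close> by (auto simp: i_def j_def)
    qed
  qed
  finally show ?thesis by (simp add: chain_sum_def)
qed

end

text \<open>Nonempty chains are sorted by their maximum \<open>Z\<close>, which contributes the last
  factor \<open>f Z Y\<close>; the empty chain gives \<open>f X Y\<close>.\<close>

lemma chain_sum_rec:
  assumes fin: "finite L"
  shows "chain_sum L f {} X Y = f X Y + (\<Sum>Z\<in>{Z\<in>L. X \<subset> Z \<and> Z \<subset> Y}. chain_sum L f {} X Z * f Z Y)"
proof -
  let ?I = "{Z\<in>L. X \<subset> Z \<and> Z \<subset> Y}"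
  have w0: "chain_weight f U V {} = f U V" for U V
    by (simp add: chain_weight_def chain_pred_def)
  have "(\<Sum>Z\<in>?I. chain_sum L f {} X Z * f Z Y) =
      (\<Sum>Z\<in>?I. \<Sum>\<G>\<in>chains_between L X Z. chain_weight f X Y (insert Z \<G>))"
  proof (intro sum.cong refl)
    fix Z assume "Z \<in> ?I"
    then have Z: "Z \<in> L" "X \<subset> Z" "Z \<subset> Y" by auto
    have "chain_weight f X Y (insert Z \<G>) = chain_weight f X Z \<G> * f Z Y" if "\<G> \<in> chains_between L X Z" for \<G>
      using chain_weight_join[OF fin Z that empty_chain, of f] by (simp add: w0)
    then show "chain_sum L f {} X Z * f Z Y = (\<Sum>\<G>\<in>chains_between L X Z. chain_weight f X Y (insert Z \<G>))"
      by (simp add: chain_sum_def sum_distrib_right)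
  qed
  also have "\<dots> = (\<Sum>(Z, \<G>)\<in>(SIGMA Z:?I. chains_between L X Z). chain_weight f X Y (insert Z \<G>))"
    using fin by (intro sum.Sigma) (auto intro: finite_chains_between)
  also have "\<dots> = (\<Sum>\<G>\<in>chains_between L X Y - {{}}. chain_weight f X Y \<G>)"
  proof -
    define i j where "i = (\<lambda>\<G>::'a set set. (\<Union>\<G>, \<G> - {\<Union>\<G>}))"
      and "j = (\<lambda>(Z::'a set, \<G>). insert Z \<G>)"
    show ?thesis
    proof (rule sum.reindex_bij_witness[of _ i j])
      fix p assume "p \<in> (SIGMA Z:?I. chains_between L X Z)"
      then obtain Z \<G> where p: "p = (Z, \<G>)" and Z: "Z \<in> L" "X \<subset> Z" "Z \<subset> Y"
        and \<G>: "\<G> \<in> chains_between L X Z" by auto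
      show "j p \<in> chains_between L X Y - {{}}"
        using chain_join[OF fin Z \<G> empty_chain] by (simp add: p j_def)
      have below: "G \<subset> Z" if "G \<in> \<G>" for G using \<G> that by (auto simp: chains_between_iff)
      then have "\<Union>(insert Z \<G>) = Z" by auto
      moreover have "insert Z \<G> - {Z} = \<G>" using below by auto
      ultimately show "i (j p) = p"
        unfolding p i_def j_def by simp
      show "chain_weight f X Y (j p) = (case p of (Z, \<G>) \<Rightarrow> chain_weight f X Y (insert Z \<G>))"
        by (simp add: p j_def)
    next
      fix \<G> assume "\<G> \<in> chains_between L X Y - {{}}"
      then have \<G>: "\<G> \<in> chains_between L X Y" and top: "\<Union>\<G> \<in> \<G>"
        using Union_chain_mem[OF fin] by auto
      then have "\<Union>\<G> \<in> ?I" unfolding chains_between_iff by blast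
      moreover have "\<G> - {\<Union>\<G>} \<in> chains_between L X (\<Union>\<G>)"
        using \<G> unfolding chains_between_iff by blast
      ultimately show "i \<G> \<in> (SIGMA Z:?I. chains_between L X Z)" by (simp add: i_def)
      show "j (i \<G>) = \<G>"
        using top by (auto simp: i_def j_def)
    qed
  qed
  finally show ?thesis
    using sum.remove[OF finite_chains_between[OF fin, of X Y] empty_chain, of "chain_weight f X Y"]
    by (simp add: chain_sum_def w0)
qed

section \<open>Palindromicity of chain sums\<close>

context ranked_family
begin

abbreviation "S \<equiv> chain_sum L \<kappa>"

text \<open>The recursion shortens chains at the top, so \<open>X\<close> stays fixed and the
  induction runs over \<open>Y\<close>. The extra \<open>x\<close> on the left reflects the degree
  \<rho> Y - \<rho> X - 1 that the sum has for flats.\<close>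

lemma chain_sum_palindromic_empty:
  assumes "X \<in> L" "Y \<in> L" "X \<subset> Y" and x: "x \<noteq> 0" "x \<noteq> 1"
  shows "x * eval_int_poly (S {} X Y) x = x ^ (\<rho> Y - \<rho> X) * eval_int_poly (S {} X Y) (inverse x)"
  using assms(2,3)
proof (induction "card Y" arbitrary: Y rule: less_induct)
  case less
  let ?k = "\<lambda>U V. eval_int_poly (\<kappa> U V) x" and ?k' = "rev_reduced x"
  let ?h = "\<lambda>Z. eval_int_poly (S {} X Z) x"
  let ?h' = "\<lambda>Z. x ^ (\<rho> Z - \<rho> X) * eval_int_poly (S {} X Z) (inverse x)"
  let ?I = "{Z\<in>L. X \<subset> Z \<and> Z \<subset> Y}"
  have h: "?h V = ?k X V + (\<Sum>Z\<in>{Z\<in>L. X \<subset> Z \<and> Z \<subset> V}. ?h Z * ?k Z V)" for V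
    by (subst chain_sum_rec[OF finite_family]) simp
  have "x * ?h Y = x * ?k X Y + (\<Sum>Z\<in>?I. ?h Z * (x * ?k Z Y))"
    unfolding h[of Y] by (simp add: distrib_left sum_distrib_left mult.left_commute)
  also have "(\<Sum>Z\<in>?I. ?h Z * (x * ?k Z Y)) =
      (\<Sum>Z\<in>?I. ?h Z * (?k' Z Y + (x - 1) * (\<Sum>W\<in>{W\<in>L. Z \<subset> W \<and> W \<subset> Y}. ?k Z W * ?k' W Y)))"
    using less.prems x by (intro sum.cong refl arg_cong2[of _ _ _ _ "(*)"] reduced_kernel) auto
  also have "\<dots> = (\<Sum>Z\<in>?I. ?h Z * ?k' Z Y) +
      (x - 1) * (\<Sum>Z\<in>?I. \<Sum>W\<in>{W\<in>L. Z \<subset> W \<and> W \<subset> Y}. ?h Z * ?k Z W * ?k' W Y)"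
    unfolding sum_distrib_left distrib_left sum.distrib mult.left_commute[of _ "x - 1"] mult.assoc ..
  also have "(\<Sum>Z\<in>?I. \<Sum>W\<in>{W\<in>L. Z \<subset> W \<and> W \<subset> Y}. ?h Z * ?k Z W * ?k' W Y) =
      (\<Sum>W\<in>?I. \<Sum>Z\<in>{Z\<in>L. X \<subset> Z \<and> Z \<subset> W}. ?h Z * ?k Z W * ?k' W Y)"
    by (intro sum_interval_swap finite_family) (auto simp: transp_def)
  \<comment> \<open>The recursion for \<open>?h\<close> at \<open>W\<close>, read backwards.\<close>
  also have "\<dots> = (\<Sum>W\<in>?I. (?h W - ?k X W) * ?k' W Y)"
    by (intro sum.cong refl, subst h) (simp add: sum_distrib_right)
  \<comment> \<open>The sum introduced here cancels the terms \<open>?k X W * ?k' W Y\<close> left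
    over from the double sum.\<close>
  also have "x * ?k X Y = ?k' X Y + (x - 1) * (\<Sum>W\<in>?I. ?k X W * ?k' W Y)"
    using assms less.prems by (intro reduced_kernel)
  finally have "x * ?h Y = ?k' X Y + (\<Sum>Z\<in>?I. (x * ?h Z) * ?k' Z Y)"
    by (simp add: algebra_simps sum_subtractf sum_distrib_left)
  also have "(\<Sum>Z\<in>?I. (x * ?h Z) * ?k' Z Y) = (\<Sum>Z\<in>?I. ?h' Z * ?k' Z Y)"
  proof (intro sum.cong refl)
    fix Z assume Z: "Z \<in> ?I"
    then have "card Z < card Y"
      using less.prems finite_member by (intro psubset_card_mono) auto
    then have "x * ?h Z = ?h' Z" using less.hyps Z by simp
    then show "(x * ?h Z) * ?k' Z Y = ?h' Z * ?k' Z Y" by (simp only:)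
  qed
  \<comment> \<open>The powers of \<open>x\<close> split at each \<open>Z\<close>, so this is the
    recursion evaluated at \<open>inverse x\<close> and rescaled.\<close>
  also have "?k' X Y + \<dots> = ?h' Y"
  proof -
    have "x ^ (\<rho> Y - \<rho> X) = x ^ (\<rho> Z - \<rho> X) * x ^ (\<rho> Y - \<rho> Z)" if "Z \<in> ?I" for Z
    proof -
      have "\<rho> Y - \<rho> X = (\<rho> Z - \<rho> X) + (\<rho> Y - \<rho> Z)"
        using rank_mono[of X Z] rank_mono[of Z Y] that assms less.prems by auto
      then show ?thesis by (simp add: power_add)
    qed
    then show ?thesis
      by (subst chain_sum_rec[OF finite_family])
        (auto simp: rev_reduced_def distrib_left sum_distrib_left mult_ac intro!: sum.cong)
  qed
  finally show ?case .
qed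

text \<open>Cutting at the maximum of \<open>\<F>\<close> leaves one member fewer below and a sum
  without prescribed members above. Each of the \<open>card \<F> + 1\<close> resulting factors
  supplies one \<open>x\<close>.\<close>

lemma chain_sum_palindromic:
  assumes "X \<in> L" "Y \<in> L" "X \<subset> Y" "\<F> \<in> chains_between L X Y" and x: "x \<noteq> 0" "x \<noteq> 1"
  shows "x ^ Suc (card \<F>) * eval_int_poly (S \<F> X Y) x =
    x ^ (\<rho> Y - \<rho> X) * eval_int_poly (S \<F> X Y) (inverse x)"
  using assms(2-4)
proof (induction "card \<F>" arbitrary: \<F> Y)
  case 0
  then have "\<F> = {}" using finite_chain[OF finite_family] by auto
  with 0 show ?case using chain_sum_palindromic_empty[OF assms(1)] x by simp
next
  case (Suc n)
  let ?T = "\<Union>\<F>"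
  let ?\<F>' = "\<F> - {?T}"
  have fin: "finite \<F>" using Suc.prems finite_chain[OF finite_family] by blast
  have "\<F> \<noteq> {}" using Suc.hyps(2) by (metis card.empty nat.distinct(1))
  then have T: "?T \<in> \<F>" by (rule Union_chain_mem[OF finite_family Suc.prems(3)])
  then have L: "?T \<in> L" "X \<subset> ?T" "?T \<subset> Y" using Suc.prems(3) unfolding chains_between_iff by blast+
  have \<F>': "?\<F>' \<in> chains_between L X ?T"
    using Suc.prems(3) unfolding chains_between_iff by blast
  have card: "n = card ?\<F>'" using Suc.hyps(2) T fin by simp
  have S: "S \<F> X Y = S ?\<F>' X ?T * S {} ?T Y"
    using chain_sum_split[OF finite_family L \<F>'] T by (simp add: insert_absorb)
  have "\<rho> Y - \<rho> X = (\<rho> ?T - \<rho> X) + (\<rho> Y - \<rho> ?T)"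
    using rank_mono[of X ?T] rank_mono[of ?T Y] L assms Suc.prems by auto
  then have pow: "x ^ (\<rho> Y - \<rho> X) = x ^ (\<rho> ?T - \<rho> X) * x ^ (\<rho> Y - \<rho> ?T)"
    by (simp add: power_add)
  have IH: "x ^ Suc n * eval_int_poly (S ?\<F>' X ?T) x =
      x ^ (\<rho> ?T - \<rho> X) * eval_int_poly (S ?\<F>' X ?T) (inverse x)"
    using Suc.hyps(1)[OF card L(1,2) \<F>'] card by simp
  have "x ^ Suc (card \<F>) * eval_int_poly (S \<F> X Y) x =
      (x ^ Suc n * eval_int_poly (S ?\<F>' X ?T) x) * (x * eval_int_poly (S {} ?T Y) x)"
    by (simp add: S flip: Suc.hyps(2))
  also have "\<dots> = x ^ (\<rho> Y - \<rho> X) * eval_int_poly (S \<F> X Y) (inverse x)"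
    unfolding IH chain_sum_palindromic_empty[OF L(1) Suc.prems(1) L(3) x] S pow by simp
  finally show ?case .
qed

end

section \<open>Whitney's rank expansion\<close>

text \<open>Expands the product of 1 - 1 over \<open>A\<close>.\<close>

lemma sum_alternating_Pow:
  assumes "finite A"
  shows "(\<Sum>B\<in>Pow A. (-1) ^ card B :: int) = (if A = {} then 1 else 0)"
proof -
  have "(\<Sum>B\<in>Pow A. (-1) ^ card B :: int) = (\<Prod>a\<in>A. 1 - 1)"
    by (subst prod_diff_conv_sum[OF assms]) simp
  then show ?thesis using assms by (simp add: power_0_left)
qed

text \<open>Serves both \<open>M\<close> and \<open>flag_matroid M \<G>\<close>. For the latter the
  axioms follow from an explicit rank formula, which bypasses basis exchange.\<close>

locale submodular_rank =
  fixes M :: "'a matroid_data"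
  assumes finite_ground: "finite (ground M)"
    and rank_mono: "A \<subseteq> B \<Longrightarrow> B \<subseteq> ground M \<Longrightarrow> rank M A \<le> rank M B"
    and rank_submodular: "A \<subseteq> ground M \<Longrightarrow> B \<subseteq> ground M \<Longrightarrow>
      rank M (A \<union> B) + rank M (A \<inter> B) \<le> rank M A + rank M B"
begin

section \<open>Closure and flats\<close>

lemma subset_closure: "A \<subseteq> ground M \<Longrightarrow> A \<subseteq> closure M A"
  by (auto simp: closure_def insert_absorb)

lemma closure_subset_ground: "closure M A \<subseteq> ground M"
  by (auto simp: closure_def)

text \<open>Submodularity for \<open>B\<close> and \<open>insert e A\<close>: their union is
  \<open>insert e B\<close> and their intersection contains \<open>A\<close>.\<close>

lemma rank_insert_eq_mono:
  assumes "A \<subseteq> B" "B \<subseteq> ground M" "e \<in> ground M" "rank M (insert e A) = rank M A"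
  shows "rank M (insert e B) = rank M B"
proof -
  have "rank M (B \<union> insert e A) + rank M (B \<inter> insert e A) \<le> rank M B + rank M (insert e A)"
    using assms by (intro rank_submodular) auto
  moreover have "rank M A \<le> rank M (B \<inter> insert e A)" using assms by (intro rank_mono) auto
  moreover have "B \<union> insert e A = insert e B" using assms(1) by auto
  moreover have "rank M B \<le> rank M (insert e B)" using assms by (intro rank_mono) auto
  ultimately show ?thesis using assms(4) by simp
qed

text \<open>Elements of the closure are adjoined one at a time; each adds no rank to
  \<open>A\<close>, hence none to a larger set.\<close>

lemma rank_closure:
  assumes "A \<subseteq> ground M"
  shows "rank M (closure M A) = rank M A"
proof -
  have "finite (closure M A)"
    using finite_ground closure_subset_ground finite_subset by blast
  moreover have "rank M (A \<union> S) = rank M A" if "finite S" "S \<subseteq> closure M A" for S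
    using that
  proof (induction S)
    case (insert e S)
    have "A \<union> S \<subseteq> ground M" using assms insert.prems closure_subset_ground[of A] by blast
    moreover have "e \<in> ground M" "rank M (insert e A) = rank M A"
      using insert.prems by (auto simp: closure_def)
    ultimately have "rank M (insert e (A \<union> S)) = rank M (A \<union> S)"
      using rank_insert_eq_mono[of A "A \<union> S" e] by simp
    with insert show ?case by simp
  qed simp
  ultimately show ?thesis
    using subset_closure[OF assms] by (metis subset_refl sup.absorb2)
qed

lemma closure_in_flats:
  assumes "A \<subseteq> ground M"
  shows "closure M A \<in> flats M"
proof -
  have "e \<in> closure M A" if "e \<in> closure M (closure M A)" for e
  proof -
    have e: "e \<in> ground M" "rank M (insert e (closure M A)) = rank M A"
      using that rank_closure[OF assms] by (auto simp: closure_def)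
    have "rank M (insert e A) \<le> rank M (insert e (closure M A))"
      using subset_closure[OF assms] closure_subset_ground[of A] e(1) by (intro rank_mono) auto
    moreover have "rank M A \<le> rank M (insert e A)"
      using e(1) assms by (intro rank_mono) auto
    ultimately show ?thesis using e by (simp add: closure_def)
  qed
  then show ?thesis
    using subset_closure[OF closure_subset_ground, of A] closure_subset_ground[of A]
    by (auto simp: flats_def)
qed

lemma closure_subset_flat:
  assumes "F \<in> flats M" "A \<subseteq> F"
  shows "closure M A \<subseteq> F"
proof
  fix e assume "e \<in> closure M A"
  then have "e \<in> closure M F"
    using assms rank_insert_eq_mono[of A F e] by (auto simp: closure_def flats_def)
  then show "e \<in> F" using assms(1) by (simp add: flats_def)
qed

lemma finite_flats: "finite (flats M)"
  by (rule finite_subset[of _ "Pow (ground M)"]) (auto simp: flats_def finite_ground)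

lemma finite_flat: "F \<in> flats M \<Longrightarrow> finite F"
  using finite_ground finite_subset by (auto simp: flats_def)

section \<open>Moebius function of the flats by inclusion-exclusion\<close>

text \<open>By \<open>interval_sums_determine\<close> it is enough to compare sums over an interval.
  The closure of \<open>X \<union> A\<close> lies in \<open>Y\<close> exactly when \<open>A\<close>
  does, so the right side becomes the alternating sum over all subsets of
  \<open>Y - X\<close>.\<close>

lemma moebius_flats:
  assumes X: "X \<in> flats M" and Y: "Y \<in> flats M" and "X \<subseteq> Y"
  shows "moebius (flats M) X Y =
    (\<Sum>A\<in>{A\<in>Pow (ground M - X). closure M (X \<union> A) = Y}. (-1) ^ card A)" (is "_ = ?f Y")
proof (rule interval_sums_determine[OF finite_flats finite_flat _ Y \<open>X \<subseteq> Y\<close>])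
  fix Y assume Y: "Y \<in> flats M" "X \<subseteq> Y"
  let ?I = "{Z\<in>flats M. X \<subseteq> Z \<and> Z \<subseteq> Y}"
  have sub: "Y \<subseteq> ground M" using Y by (simp add: flats_def)
  have "(\<Sum>Z\<in>?I. ?f Z) = (\<Sum>Z\<in>?I. \<Sum>A\<in>{A\<in>Pow (Y - X). closure M (X \<union> A) = Z}. (-1) ^ card A)"
  proof (intro sum.cong refl)
    fix Z assume Z: "Z \<in> ?I"
    have "A \<subseteq> Y" if "A \<subseteq> ground M - X" "closure M (X \<union> A) = Z" for A
      using subset_closure[of "X \<union> A"] that Z sub by blast
    then show "{A\<in>Pow (ground M - X). closure M (X \<union> A) = Z} = {A\<in>Pow (Y - X). closure M (X \<union> A) = Z}"
      using sub by blast
  qed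
  also have "\<dots> = (\<Sum>A\<in>Pow (Y - X). (-1) ^ card A)"
  proof (intro sum.group)
    show "(\<lambda>A. closure M (X \<union> A)) ` Pow (Y - X) \<subseteq> ?I"
    proof
      fix Z assume "Z \<in> (\<lambda>A. closure M (X \<union> A)) ` Pow (Y - X)"
      then obtain A where A: "A \<subseteq> Y - X" "Z = closure M (X \<union> A)" by blast
      then have XA: "X \<union> A \<subseteq> Y" using Y by blast
      then have "X \<union> A \<subseteq> ground M" using sub by (rule subset_trans)
      then show "Z \<in> ?I"
        using closure_in_flats subset_closure closure_subset_flat[OF Y(1) XA] unfolding A(2) by blast
    qed
  qed (use finite_flats finite_flat Y in auto)
  also have "\<dots> = (if X = Y then 1 else 0)"
    using sum_alternating_Pow[of "Y - X"] finite_flat Y by auto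
  also have "\<dots> = (\<Sum>Z\<in>?I. moebius (flats M) X Z)"
    using X Y finite_flats finite_flat by (intro sum_moebius_right[symmetric]) auto
  finally show "(\<Sum>Z\<in>?I. moebius (flats M) X Z) = (\<Sum>Z\<in>?I. ?f Z)" ..
qed auto

text \<open>The Moebius values are replaced by sums over the \<open>A\<close> for which
  \<open>X \<union> A\<close> has closure \<open>Z\<close>, and hence the rank of \<open>Z\<close>.
  The resulting sum over subsets can be split along the layers of a flag.\<close>

lemma interval_char_poly_rank_expansion:
  assumes X: "X \<in> flats M" and Y: "Y \<in> flats M" and "X \<subseteq> Y"
  shows "interval_char_poly (flats M) (rank M) X Y =
    (\<Sum>A\<in>Pow (Y - X). monom ((-1) ^ card A) (rank M Y - rank M (X \<union> A)))"
proof -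
  let ?I = "{Z\<in>flats M. X \<subseteq> Z \<and> Z \<subseteq> Y}"
  let ?g = "\<lambda>A. monom ((-1) ^ card A) (rank M Y - rank M (X \<union> A)) :: int poly"
  have sub: "Y \<subseteq> ground M" using Y by (simp add: flats_def)
  have "interval_char_poly (flats M) (rank M) X Y =
      (\<Sum>Z\<in>?I. \<Sum>A\<in>{A\<in>Pow (Y - X). closure M (X \<union> A) = Z}. ?g A)"
    unfolding interval_char_poly_def
  proof (intro sum.cong refl)
    fix Z assume Z: "Z \<in> ?I"
    have "A \<subseteq> Y" if "A \<subseteq> ground M - X" "closure M (X \<union> A) = Z" for A
      using subset_closure[of "X \<union> A"] that Z sub by blast
    then have eq: "{A\<in>Pow (ground M - X). closure M (X \<union> A) = Z} = {A\<in>Pow (Y - X). closure M (X \<union> A) = Z}"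
      using sub by blast
    have "monom (moebius (flats M) X Z) (rank M Y - rank M Z) =
        (\<Sum>A\<in>{A\<in>Pow (Y - X). closure M (X \<union> A) = Z}. monom ((-1) ^ card A) (rank M Y - rank M Z))"
      using X Z eq by (simp add: moebius_flats monom_sum)
    also have "\<dots> = (\<Sum>A\<in>{A\<in>Pow (Y - X). closure M (X \<union> A) = Z}. ?g A)"
    proof (intro sum.cong refl)
      fix A assume A: "A \<in> {A\<in>Pow (Y - X). closure M (X \<union> A) = Z}"
      then have "X \<union> A \<subseteq> ground M" using sub assms(3) by blast
      from rank_closure[OF this] A
      show "monom ((-1) ^ card A) (rank M Y - rank M Z) = ?g A" by auto
    qed
    finally show "monom (moebius (flats M) X Z) (rank M Y - rank M Z) =
        (\<Sum>A\<in>{A\<in>Pow (Y - X). closure M (X \<union> A) = Z}. ?g A)" .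
  qed
  also have "\<dots> = sum ?g (Pow (Y - X))"
  proof (intro sum.group)
    show "(\<lambda>A. closure M (X \<union> A)) ` Pow (Y - X) \<subseteq> ?I"
    proof
      fix Z assume "Z \<in> (\<lambda>A. closure M (X \<union> A)) ` Pow (Y - X)"
      then obtain A where A: "A \<subseteq> Y - X" "Z = closure M (X \<union> A)" by blast
      then have XA: "X \<union> A \<subseteq> Y" using assms(3) by blast
      then have "X \<union> A \<subseteq> ground M" using sub by (rule subset_trans)
      then show "Z \<in> ?I"
        using closure_in_flats subset_closure closure_subset_flat[OF Y XA] unfolding A(2) by blast
    qed
  qed (use finite_flats finite_flat Y in auto)
  finally show ?thesis .
qed

lemma char_poly_rank_expansion:
  assumes "closure M {} = {}"
  shows "char_poly M = (\<Sum>A\<in>Pow (ground M). monom ((-1) ^ card A) (rank M (ground M) - rank M A))"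
proof -
  have "closure M (ground M) = ground M"
    using subset_closure closure_subset_ground by blast
  then have flats: "{} \<in> flats M" "ground M \<in> flats M"
    using assms by (auto simp: flats_def)
  have "{Z\<in>flats M. {} \<subseteq> Z \<and> Z \<subseteq> ground M} = flats M" by (auto simp: flats_def)
  then have "char_poly M = interval_char_poly (flats M) (rank M) {} (ground M)"
    by (simp add: char_poly_def interval_char_poly_def rk_def assms)
  with interval_char_poly_rank_expansion[OF flats] show ?thesis by simp
qed

sublocale flats: ranked_family "flats M" "rank M"
proof unfold_locales
  show "rank M X \<le> rank M Y" if "X \<in> flats M" "Y \<in> flats M" "X \<subseteq> Y" for X Y
    using that by (intro rank_mono) (auto simp: flats_def)
qed (simp_all add: finite_flats finite_flat)

end

section \<open>Layers of a chain\<close>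

text \<open>The chain is finite, so the union of the members below \<open>G\<close> is itself one of
  them if there are any.\<close>

lemma chain_pred_cases:
  assumes "finite L" "\<G> \<in> chains_between L X Y" "X \<subset> Y" and G: "G \<in> insert Y \<G>"
  shows "chain_pred X \<G> G \<in> insert X \<G>" and "chain_pred X \<G> G \<subset> G"
proof -
  let ?\<H> = "{H\<in>\<G>. H \<subset> G}"
  have XG: "X \<subset> G" using assms unfolding chains_between_iff by blast
  have "chain_pred X \<G> G \<in> insert X \<G> \<and> chain_pred X \<G> G \<subset> G"
  proof (cases "?\<H> = {}")
    case True
    then have "chain_pred X \<G> G = X" unfolding chain_pred_def by blast
    with XG show ?thesis by simp
  next
    case False
    have "?\<H> \<in> chains_between L X Y" using assms(2) unfolding chains_between_iff by blast
    from Union_chain_mem[OF assms(1) this False] have U: "\<Union>?\<H> \<in> ?\<H>" .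
    then have "X \<subseteq> \<Union>?\<H>" using assms(2) unfolding chains_between_iff by blast
    then have "chain_pred X \<G> G = \<Union>?\<H>" unfolding chain_pred_def by blast
    with U show ?thesis by auto
  qed
  then show "chain_pred X \<G> G \<in> insert X \<G>" "chain_pred X \<G> G \<subset> G" by auto
qed

text \<open>The smaller of the two is among the sets whose union is the predecessor of the larger.
  Besides disjoint layers this gives the comparabilities in \<open>rank_flag\<close>.\<close>

lemma chain_below_pred:
  assumes "\<G> \<in> chains_between L X Y" "G \<in> insert Y \<G>" "H \<in> insert Y \<G>" "G \<noteq> H"
  shows "G \<subseteq> chain_pred X \<G> H \<or> H \<subseteq> chain_pred X \<G> G"
proof -
  have "G \<subset> H \<or> H \<subset> G" "Y \<noteq> G \<Longrightarrow> G \<in> \<G>" "Y \<noteq> H \<Longrightarrow> H \<in> \<G>" "\<forall>G\<in>\<G>. G \<subset> Y"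
    using assms unfolding chains_between_iff by blast+
  then show ?thesis using assms(2,3) unfolding chain_pred_def by blast
qed

lemma disjoint_family_on_layers:
  assumes "\<G> \<in> chains_between L X Y"
  shows "disjoint_family_on (\<lambda>G. G - chain_pred X \<G> G) (insert Y \<G>)"
  using chain_below_pred[OF assms] unfolding disjoint_family_on_def by blast

lemma Union_layers:
  assumes "finite L" "\<G> \<in> chains_between L X Y" "X \<subset> Y"
  shows "(\<Union>G\<in>insert Y \<G>. G - chain_pred X \<G> G) = Y - X"
proof
  show "(\<Union>G\<in>insert Y \<G>. G - chain_pred X \<G> G) \<subseteq> Y - X"
    using assms(2) unfolding chains_between_iff chain_pred_def by blast
  show "Y - X \<subseteq> (\<Union>G\<in>insert Y \<G>. G - chain_pred X \<G> G)"
  proof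
    fix e assume e: "e \<in> Y - X"
    \<comment> \<open>The layer containing \<open>e\<close> belongs to the smallest member through
      \<open>e\<close>.\<close>
    let ?\<H> = "{H\<in>insert Y \<G>. e \<in> H}"
    have "finite ?\<H>" "?\<H> \<noteq> {}"
      using finite_chain[OF assms(1,2)] e by auto
    from finite_has_minimal[OF this] obtain G where G: "G \<in> ?\<H>" and min: "\<forall>H\<in>?\<H>. H \<subseteq> G \<longrightarrow> G = H"
      by blast
    have "e \<notin> chain_pred X \<G> G" using e min unfolding chain_pred_def by blast
    with G show "e \<in> (\<Union>G\<in>insert Y \<G>. G - chain_pred X \<G> G)" by blast
  qed
qed

text \<open>A subset of a disjoint union is a tuple of subsets of the blocks, so this is the
  distributive law.\<close>

lemma sum_Pow_UN_prod:
  fixes f :: "'i \<Rightarrow> 'a set \<Rightarrow> 'b::comm_semiring_1"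
  assumes "finite I" "disjoint_family_on D I"
  shows "(\<Sum>A\<in>Pow (\<Union>i\<in>I. D i). \<Prod>i\<in>I. f i (A \<inter> D i)) = (\<Prod>i\<in>I. \<Sum>A\<in>Pow (D i). f i A)"
  using assms
proof (induction I)
  case (insert k I)
  let ?U = "\<Union>i\<in>I. D i"
  have disj: "D k \<inter> ?U = {}" and IH: "(\<Sum>A\<in>Pow ?U. \<Prod>i\<in>I. f i (A \<inter> D i)) = (\<Prod>i\<in>I. \<Sum>A\<in>Pow (D i). f i A)"
    using insert by (auto simp: disjoint_family_on_insert)
  have "(\<Sum>A\<in>Pow (\<Union>i\<in>insert k I. D i). \<Prod>i\<in>insert k I. f i (A \<inter> D i)) =
      (\<Sum>(B, C)\<in>Pow (D k) \<times> Pow ?U. f k B * (\<Prod>i\<in>I. f i (C \<inter> D i)))"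
  proof (rule sum.reindex_bij_witness[of _ "\<lambda>(B, C). B \<union> C" "\<lambda>A. (A \<inter> D k, A \<inter> ?U)"])
    fix A assume "A \<in> Pow (\<Union>i\<in>insert k I. D i)"
    have "A \<inter> ?U \<inter> D i = A \<inter> D i" if "i \<in> I" for i using that by blast
    then show "(case (A \<inter> D k, A \<inter> ?U) of (B, C) \<Rightarrow> f k B * (\<Prod>i\<in>I. f i (C \<inter> D i))) =
        (\<Prod>i\<in>insert k I. f i (A \<inter> D i))"
      using insert.hyps by simp
  qed (use disj in auto)
  also have "\<dots> = (\<Prod>i\<in>insert k I. \<Sum>A\<in>Pow (D i). f i A)"
    using insert.hyps by (simp add: sum_product flip: IH sum.cartesian_product)
  finally show ?case .
qed simp

section \<open>The matroid of a flag\<close>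

context matroid
begin

section \<open>Bases adapted to chains, and submodularity\<close>

text \<open>A basis of maximal weight for the sum of the indicators exists by finiteness, and
  \<open>bases_initial_matroid_chain\<close> makes it optimal on every member at once.\<close>

lemma ex_basis_of_chain:
  assumes "subset.chain (Pow (ground M)) \<C>"
  shows "\<exists>B\<in>bases M. \<forall>C\<in>\<C>. card (C \<inter> B) = rank M C"
proof -
  let ?w = "\<lambda>e. \<Sum>G\<in>\<C>. 1 * indicator G e :: real"
  have "Max (sum ?w ` bases M) \<in> sum ?w ` bases M"
    using finite_bases ex_basis by (intro Max_in) auto
  then obtain B where B: "B \<in> bases M" "sum ?w B = Max (sum ?w ` bases M)" by auto
  then have "B \<in> bases (initial_matroid M ?w)"
    using finite_bases by (simp add: initial_matroid_def)
  then show ?thesis using bases_initial_matroid_chain[OF assms, of "\<lambda>_. 1"] by auto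
qed

lemma rank_le_of_subset:
  assumes "A \<subseteq> B"
  shows "rank M A \<le> rank M B"
proof -
  obtain C where C: "C \<in> bases M" "card (A \<inter> C) = rank M A" using ex_basis_rank by blast
  have "card (A \<inter> C) \<le> card (B \<inter> C)"
    using assms finite_basis[OF C(1)] by (intro card_mono) auto
  with C card_inter_le_rank[OF C(1), of B] show ?thesis by simp
qed

text \<open>Counting takes place in one basis that is optimal for both \<open>A \<inter> B\<close>
  and \<open>A \<union> B\<close>, where cardinalities are modular.\<close>

lemma rank_Un_Int:
  assumes "A \<subseteq> ground M" "B \<subseteq> ground M"
  shows "rank M (A \<union> B) + rank M (A \<inter> B) \<le> rank M A + rank M B"
proof -
  have "subset.chain (Pow (ground M)) {A \<inter> B, A \<union> B}"
    using assms by (auto simp: subset_chain_def)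
  then obtain C where C: "C \<in> bases M" "card ((A \<inter> B) \<inter> C) = rank M (A \<inter> B)"
      "card ((A \<union> B) \<inter> C) = rank M (A \<union> B)"
    using ex_basis_of_chain by blast
  have "(A \<inter> C) \<union> (B \<inter> C) = (A \<union> B) \<inter> C" "(A \<inter> C) \<inter> (B \<inter> C) = (A \<inter> B) \<inter> C" by auto
  then have "card (A \<inter> C) + card (B \<inter> C) = rank M (A \<union> B) + rank M (A \<inter> B)"
    using card_Un_Int[of "A \<inter> C" "B \<inter> C"] finite_basis[OF C(1)] C by simp
  then show ?thesis using card_inter_le_rank[OF C(1), of A] card_inter_le_rank[OF C(1), of B] by simp
qed

sublocale submodular_rank M
  by unfold_locales (use finite_ground rank_le_of_subset rank_Un_Int in auto)

lemma rank_empty: "rank M {} = 0"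
  using ex_basis_rank[of "{}"] by simp

lemma closure_empty:
  assumes "loopless M"
  shows "closure M {} = {}"
proof -
  have "e \<notin> closure M {}" for e
  proof
    assume e: "e \<in> closure M {}"
    then have "e \<in> ground M" by (simp add: closure_def)
    then obtain B where "B \<in> bases M" "e \<in> B" using assms by (auto simp: loopless_def)
    with card_inter_le_rank[of B "{e}"] have "rank M {e} \<ge> 1" by simp
    with e show False by (simp add: closure_def rank_empty)
  qed
  then show ?thesis by blast
qed

end

section \<open>Rank function and characteristic polynomial of a flag matroid\<close>

text \<open>Looplessness makes \<open>{}\<close> the bottom flat, and nonemptiness keeps it strictly
  below \<open>ground M\<close>, so every layer is nonempty.\<close>

locale matroid_flag = matroid +
  fixes \<G>
  assumes loopless: "loopless M" and nonempty: "ground M \<noteq> {}"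
    and chain: "\<G> \<in> chains_between (flats M) {} (ground M)"
begin

abbreviation "pred \<equiv> chain_pred {} \<G>"
abbreviation "I \<equiv> insert (ground M) \<G>"
abbreviation "layer G \<equiv> G - pred G"

lemma empty_flat: "{} \<in> flats M"
  using closure_empty[OF loopless] by (simp add: flats_def)

lemma ground_flat: "ground M \<in> flats M"
  using subset_closure closure_subset_ground by (auto simp: flats_def)

lemma member_flat: "G \<in> I \<Longrightarrow> G \<in> flats M"
  using chain ground_flat by (auto simp: chains_between_iff)

lemma finite_I: "finite I"
  using finite_chain[OF finite_flats chain] by simp

lemma member_subset: "G \<in> I \<Longrightarrow> G \<subseteq> ground M"
  using member_flat by (auto simp: flats_def)

lemma pred_psubset: "G \<in> I \<Longrightarrow> pred G \<subset> G"
  and pred_mem: "G \<in> I \<Longrightarrow> pred G \<in> insert {} \<G>"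
proof -
  have "{} \<subset> ground M" using nonempty by blast
  note cases = chain_pred_cases[OF finite_flats chain this]
  show "G \<in> I \<Longrightarrow> pred G \<subset> G" "G \<in> I \<Longrightarrow> pred G \<in> insert {} \<G>" by (fact cases)+
qed

lemma pred_flat: "G \<in> I \<Longrightarrow> pred G \<in> flats M"
  using pred_mem[of G] empty_flat member_flat[of "pred G"] by auto

lemma layers_disjoint: "disjoint_family_on layer I"
  by (rule disjoint_family_on_layers[OF chain])

lemma Union_layer: "(\<Union>G\<in>I. layer G) = ground M"
  using Union_layers[OF finite_flats chain] nonempty by auto

lemma card_layers:
  assumes "A \<subseteq> ground M"
  shows "card A = (\<Sum>G\<in>I. card (A \<inter> layer G))"
proof -
  have "A = (\<Union>G\<in>I. A \<inter> layer G)" using assms Union_layer by blast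
  moreover have "disjoint_family_on (\<lambda>G. A \<inter> layer G) I"
    using layers_disjoint unfolding disjoint_family_on_def by blast
  ultimately show ?thesis
    using card_UN_disjoint'[of "\<lambda>G. A \<inter> layer G" I] finite_I assms finite_ground
    by (metis finite_Int finite_subset)
qed

lemma bases_flag:
  "bases (flag_matroid M \<G>) = {B \<in> bases M. \<forall>G\<in>\<G>. card (G \<inter> B) = rank M G}"
proof -
  have "subset.chain (Pow (ground M)) \<G>"
    using chain unfolding chains_between_iff subset_chain_def by blast
  from bases_initial_matroid_chain[OF this, of "\<lambda>_. 1"] show ?thesis
    by (simp add: flag_matroid_def)
qed

lemma ground_flag: "ground (flag_matroid M \<G>) = ground M"
  by (simp add: flag_matroid_def initial_matroid_def)

text \<open>This is the rank of the direct sum of the minors M|G/z(G), with \<open>pred G\<close> as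
  z(G); the ranks of the predecessors stand on the left to avoid natural subtraction. One flag basis
  attains all terms on the right, and every other one is bounded by them.\<close>

lemma rank_flag:
  assumes A: "A \<subseteq> ground M"
  shows "rank (flag_matroid M \<G>) A + (\<Sum>G\<in>I. rank M (pred G)) = (\<Sum>G\<in>I. rank M (A \<inter> G \<union> pred G))"
proof -
  \<comment> \<open>A flag basis meets each \<open>pred G\<close> in exactly its rank; the rest of
    each term counts the part of \<open>A \<inter> B\<close> in the layer.\<close>
  have count: "card (A \<inter> B) + (\<Sum>G\<in>I. rank M (pred G)) = (\<Sum>G\<in>I. card ((A \<inter> G \<union> pred G) \<inter> B))"
    if "B \<in> bases (flag_matroid M \<G>)" for B
  proof -
    have B: "finite B" "B \<in> bases M" "\<forall>G\<in>\<G>. card (G \<inter> B) = rank M G"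
      using that finite_basis by (auto simp: bases_flag)
    have "card ((A \<inter> G \<union> pred G) \<inter> B) = card (A \<inter> B \<inter> layer G) + rank M (pred G)" if "G \<in> I" for G
    proof -
      have "(A \<inter> G \<union> pred G) \<inter> B = (A \<inter> B \<inter> layer G) \<union> (pred G \<inter> B)"
        using pred_psubset[OF that] by auto
      moreover have "card (pred G \<inter> B) = rank M (pred G)"
        using pred_mem[OF that] B(3) by (auto simp: rank_empty)
      moreover have "card ((A \<inter> B \<inter> layer G) \<union> (pred G \<inter> B)) = card (A \<inter> B \<inter> layer G) + card (pred G \<inter> B)"
        using B(1) by (intro card_Un_disjoint) auto
      ultimately show ?thesis by (simp only:)
    qed
    then show ?thesis using card_layers[of "A \<inter> B"] A by (simp add: sum.distrib le_infI1)
  qed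
  \<comment> \<open>Inserting \<open>A \<inter> G \<union> pred G\<close> between
    \<open>pred G\<close> and \<open>G\<close> again gives a chain, so a single basis is optimal for
    all these sets. As the \<open>G\<close> themselves are included, it is a flag basis.\<close>
  let ?\<C> = "\<Union>G\<in>I. {pred G, A \<inter> G \<union> pred G, G}"
  have "subset.chain (Pow (ground M)) ?\<C>"
    unfolding subset_chain_def
  proof (intro conjI ballI)
    show "?\<C> \<subseteq> Pow (ground M)"
    proof
      fix C assume "C \<in> ?\<C>"
      then obtain G where G: "G \<in> I" "C \<in> {pred G, A \<inter> G \<union> pred G, G}" by blast
      then have "C \<subseteq> G" using pred_psubset[OF G(1)] by auto
      then show "C \<in> Pow (ground M)" using member_subset[OF G(1)] by blast
    qed
    fix C D assume "C \<in> ?\<C>" "D \<in> ?\<C>"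
    then obtain G H where GH: "G \<in> I" "H \<in> I"
      and C: "C \<in> {pred G, A \<inter> G \<union> pred G, G}" and D: "D \<in> {pred H, A \<inter> H \<union> pred H, H}" by blast
    show "C \<subseteq> D \<or> D \<subseteq> C"
    proof (cases "G = H")
      case True
      then show ?thesis using C D pred_psubset[OF GH(1)] by auto
    next
      case False
      have "pred G \<subseteq> C" "C \<subseteq> G" "pred H \<subseteq> D" "D \<subseteq> H"
        using C D pred_psubset[OF GH(1)] pred_psubset[OF GH(2)] by auto
      then show ?thesis
        using chain_below_pred[OF chain GH False] by (meson subset_trans)
    qed
  qed
  then obtain B where B: "B \<in> bases M" and max: "\<forall>C\<in>?\<C>. card (C \<inter> B) = rank M C"
    using ex_basis_of_chain by blast
  have Bf: "B \<in> bases (flag_matroid M \<G>)"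
    using B max by (simp add: bases_flag)
  have "rank (flag_matroid M \<G>) A = card (A \<inter> B)"
    unfolding rank_def
  proof (rule Max_eqI)
    show "finite ((\<lambda>B. card (A \<inter> B)) ` bases (flag_matroid M \<G>))"
      using finite_bases by (simp add: bases_flag)
    show "card (A \<inter> B) \<in> (\<lambda>B. card (A \<inter> B)) ` bases (flag_matroid M \<G>)"
      using Bf by blast
    fix n assume "n \<in> (\<lambda>B. card (A \<inter> B)) ` bases (flag_matroid M \<G>)"
    then obtain B' where B': "B' \<in> bases (flag_matroid M \<G>)" "n = card (A \<inter> B')" by blast
    have "(\<Sum>G\<in>I. card ((A \<inter> G \<union> pred G) \<inter> B')) \<le> (\<Sum>G\<in>I. card ((A \<inter> G \<union> pred G) \<inter> B))"
    proof (rule sum_mono)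
      fix G assume "G \<in> I"
      then have "card ((A \<inter> G \<union> pred G) \<inter> B) = rank M (A \<inter> G \<union> pred G)"
        using max by blast
      moreover have "B' \<in> bases M" using B'(1) by (simp add: bases_flag)
      ultimately show "card ((A \<inter> G \<union> pred G) \<inter> B') \<le> card ((A \<inter> G \<union> pred G) \<inter> B)"
        using card_inter_le_rank[of B'] by simp
    qed
    with count[OF Bf] count[OF B'(1)] B'(2) show "n \<le> card (A \<inter> B)" by linarith
  qed
  moreover have "(\<Sum>G\<in>I. card ((A \<inter> G \<union> pred G) \<inter> B)) = (\<Sum>G\<in>I. rank M (A \<inter> G \<union> pred G))"
    using max by (intro sum.cong) auto
  ultimately show ?thesis using count[OF Bf] by simp
qed

lemma layer_Un_pred_subset: "G \<in> I \<Longrightarrow> A \<inter> G \<union> pred G \<subseteq> ground M"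
  using pred_psubset[of G] member_subset[of G] by blast

text \<open>Up to a constant the rank is the sum in \<open>rank_flag\<close>, and A \<mapsto> A
  \<inter> G \<union> pred G preserves inclusions, unions and intersections.\<close>

sublocale flag: submodular_rank "flag_matroid M \<G>"
proof unfold_locales
  show "finite (ground (flag_matroid M \<G>))" by (simp add: ground_flag finite_ground)
  fix A B assume A: "A \<subseteq> B" and "B \<subseteq> ground (flag_matroid M \<G>)"
  then have B: "B \<subseteq> ground M" by (simp add: ground_flag)
  have "(\<Sum>G\<in>I. rank M (A \<inter> G \<union> pred G)) \<le> (\<Sum>G\<in>I. rank M (B \<inter> G \<union> pred G))"
    using A by (intro sum_mono rank_le_of_subset) auto
  then show "rank (flag_matroid M \<G>) A \<le> rank (flag_matroid M \<G>) B"
    using rank_flag[of A] rank_flag[OF B] subset_trans[OF A B] by linarith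
next
  fix A B assume "A \<subseteq> ground (flag_matroid M \<G>)" "B \<subseteq> ground (flag_matroid M \<G>)"
  then have AB: "A \<subseteq> ground M" "B \<subseteq> ground M" by (simp_all add: ground_flag)
  have "(\<Sum>G\<in>I. rank M ((A \<union> B) \<inter> G \<union> pred G) + rank M ((A \<inter> B) \<inter> G \<union> pred G)) \<le>
      (\<Sum>G\<in>I. rank M (A \<inter> G \<union> pred G) + rank M (B \<inter> G \<union> pred G))"
  proof (rule sum_mono)
    fix G assume "G \<in> I"
    have "(A \<union> B) \<inter> G \<union> pred G = (A \<inter> G \<union> pred G) \<union> (B \<inter> G \<union> pred G)"
      "(A \<inter> B) \<inter> G \<union> pred G = (A \<inter> G \<union> pred G) \<inter> (B \<inter> G \<union> pred G)" by auto
    then show "rank M ((A \<union> B) \<inter> G \<union> pred G) + rank M ((A \<inter> B) \<inter> G \<union> pred G) \<le>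
        rank M (A \<inter> G \<union> pred G) + rank M (B \<inter> G \<union> pred G)"
      using rank_Un_Int[OF layer_Un_pred_subset layer_Un_pred_subset] \<open>G \<in> I\<close> by simp
  qed
  then have "(\<Sum>G\<in>I. rank M ((A \<union> B) \<inter> G \<union> pred G)) + (\<Sum>G\<in>I. rank M ((A \<inter> B) \<inter> G \<union> pred G)) \<le>
      (\<Sum>G\<in>I. rank M (A \<inter> G \<union> pred G)) + (\<Sum>G\<in>I. rank M (B \<inter> G \<union> pred G))"
    unfolding sum.distrib .
  moreover have "A \<inter> B \<subseteq> ground M" "A \<union> B \<subseteq> ground M" using AB by auto
  ultimately show "rank (flag_matroid M \<G>) (A \<union> B) + rank (flag_matroid M \<G>) (A \<inter> B) \<le>
      rank (flag_matroid M \<G>) A + rank (flag_matroid M \<G>) B"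
    using AB rank_flag[of A] rank_flag[of B] rank_flag[of "A \<inter> B"] rank_flag[of "A \<union> B"] by linarith
qed

text \<open>An element of the layer of \<open>G\<close> lies outside the flat \<open>pred G\<close>,
  so it strictly raises that summand of the rank.\<close>

lemma closure_flag_empty: "closure (flag_matroid M \<G>) {} = {}"
proof -
  have "e \<notin> closure (flag_matroid M \<G>) {}" for e
  proof
    assume "e \<in> closure (flag_matroid M \<G>) {}"
    then have e: "e \<in> ground M" and eq: "rank (flag_matroid M \<G>) {e} = rank (flag_matroid M \<G>) {}"
      by (auto simp: closure_def ground_flag)
    obtain G where G: "G \<in> I" "e \<in> layer G" using e Union_layer by blast
    have "rank M (pred G) < rank M ({e} \<inter> G \<union> pred G)"
    proof (rule ccontr)
      assume "\<not> ?thesis"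
      moreover have "{e} \<inter> G \<union> pred G = insert e (pred G)" using G by auto
      ultimately have "rank M (insert e (pred G)) = rank M (pred G)"
        using rank_le_of_subset[OF subset_insertI[of "pred G" e]] by simp
      then have "e \<in> closure M (pred G)" using e by (simp add: closure_def)
      with pred_flat[OF G(1)] G(2) show False by (simp add: flats_def)
    qed
    then have "(\<Sum>G\<in>I. rank M ({} \<inter> G \<union> pred G)) < (\<Sum>G\<in>I. rank M ({e} \<inter> G \<union> pred G))"
    proof (intro sum_strict_mono_ex1 finite_I ballI)
      show "\<exists>G\<in>I. rank M ({} \<inter> G \<union> pred G) < rank M ({e} \<inter> G \<union> pred G)"
        using G(1) \<open>rank M (pred G) < _\<close> by (intro bexI[of _ G]) simp_all
    qed (auto intro: rank_le_of_subset)
    with rank_flag[of "{}"] rank_flag[of "{e}"] e eq show False by simp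
  qed
  then show ?thesis by blast
qed

text \<open>In Whitney's expansion the sign is multiplicative and the corank additive over the
  layers. Hence the sum over subsets factors, and each factor is Whitney's expansion of one
  interval.\<close>

lemma char_poly_flag:
  "char_poly (flag_matroid M \<G>) = (\<Prod>G\<in>I. interval_char_poly (flats M) (rank M) (pred G) G)"
proof -
  let ?r = "rank (flag_matroid M \<G>)"
  let ?f = "\<lambda>G A. monom ((-1) ^ card A) (rank M G - rank M (pred G \<union> A)) :: int poly"
  have summand: "monom ((-1) ^ card A) (?r (ground M) - ?r A) = (\<Prod>G\<in>I. ?f G (A \<inter> layer G))"
    if "A \<in> Pow (ground M)" for A
  proof -
    have A: "A \<subseteq> ground M" using that by simp
    have eq: "A \<inter> G \<union> pred G = pred G \<union> (A \<inter> layer G)" if "G \<in> I" for G by blast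
    have "ground M \<inter> G \<union> pred G = G" if "G \<in> I" for G
      using member_subset[OF that] pred_psubset[OF that] by blast
    then have "?r (ground M) + (\<Sum>G\<in>I. rank M (pred G)) = (\<Sum>G\<in>I. rank M G)"
      using rank_flag[of "ground M"] by simp
    moreover have "?r A + (\<Sum>G\<in>I. rank M (pred G)) = (\<Sum>G\<in>I. rank M (pred G \<union> (A \<inter> layer G)))"
      using rank_flag[OF A] eq by simp
    ultimately have "?r (ground M) - ?r A = (\<Sum>G\<in>I. rank M G) - (\<Sum>G\<in>I. rank M (pred G \<union> (A \<inter> layer G)))"
      by linarith
    \<comment> \<open>Natural subtraction distributes over the sum because each subtrahend is the
      rank of a subset of \<open>G\<close>.\<close>
    also have "\<dots> = (\<Sum>G\<in>I. rank M G - rank M (pred G \<union> (A \<inter> layer G)))"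
      using pred_psubset by (intro sum_subtractf_nat[symmetric] rank_le_of_subset) blast
    finally show ?thesis
      by (simp add: prod_monom card_layers[OF A] power_sum)
  qed
  have "char_poly (flag_matroid M \<G>) = (\<Sum>A\<in>Pow (\<Union>G\<in>I. layer G). \<Prod>G\<in>I. ?f G (A \<inter> layer G))"
    unfolding Union_layer
    using flag.char_poly_rank_expansion[OF closure_flag_empty] summand by (simp add: ground_flag)
  also have "\<dots> = (\<Prod>G\<in>I. \<Sum>A\<in>Pow (layer G). ?f G A)"
    by (rule sum_Pow_UN_prod[OF finite_I layers_disjoint])
  also have "\<dots> = (\<Prod>G\<in>I. interval_char_poly (flats M) (rank M) (pred G) G)"
    using pred_flat member_flat pred_psubset
    by (intro prod.cong refl interval_char_poly_rank_expansion[symmetric]) auto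
  finally show ?thesis .
qed

text \<open>There are \<open>card \<G> + 1\<close> intervals, each giving a factor q - 1: one is
  removed by the reduction, the others by the denominator.\<close>

lemma reduced_char_poly_flag:
  "reduced_char_poly (flag_matroid M \<G>) / (q - 1) ^ card \<G> = to_fract (chain_weight flats.\<kappa> {} (ground M) \<G>)"
proof -
  have q1: "to_fract [:-1, 1:] = q - 1"
    unfolding q_def to_fract_1[symmetric] to_fract_diff[symmetric] by (simp add: one_pCons)
  have "ground M \<notin> \<G>" "finite \<G>" using chain finite_I by (auto simp: chains_between_iff)
  then have "card I = Suc (card \<G>)" by simp
  have "char_poly (flag_matroid M \<G>) = (\<Prod>G\<in>I. [:-1, 1:] * flats.\<kappa> (pred G) G)"
    unfolding char_poly_flag
    using pred_flat member_flat pred_psubset by (intro prod.cong refl flats.char_eq_reduced) auto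
  also have "\<dots> = [:-1, 1:] ^ Suc (card \<G>) * chain_weight flats.\<kappa> {} (ground M) \<G>"
    by (simp only: prod.distrib prod_constant \<open>card I = _\<close> chain_weight_def)
  finally have "to_fract (char_poly (flag_matroid M \<G>)) =
      (q - 1) ^ Suc (card \<G>) * to_fract (chain_weight flats.\<kappa> {} (ground M) \<G>)"
    by (simp only: to_fract_mult to_fract_power q1)
  then show ?thesis using q_neq_1 by (simp add: reduced_char_poly_def)
qed

end

section \<open>Palindromicity of the Poincare polynomial\<close>

theorem theorem4p1:
  fixes M :: "'a matroid_data" and \<F> :: "'a set set"
  assumes "matroid M" and "ground M \<noteq> {}" and "loopless M"
    and "\<F> \<in> proper_flags M"
  shows "eval_int_poly (poincare_poly M \<F>) (inverse q) =
    q powi (- (int (rk M) - 1 - int (card \<F>))) * eval_int_poly (poincare_poly M \<F>) q"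
proof -
  interpret matroid M by fact
  let ?E = "ground M"
  \<comment> \<open>Looplessness gives the bottom \<open>{}\<close>; leaving out \<open>?E\<close>
    makes every member of the flag a proper subset of it.\<close>
  have proper_flags: "proper_flags M = chains_between (flats M) {} ?E"
  proof -
    have "F \<subseteq> ?E" if "F \<in> flats M" for F using that by (simp add: flats_def)
    then have "{F \<in> flats M. {} \<subset> F \<and> F \<subset> ?E} = {F \<in> flats M. {} \<subset> F} - {?E}"
      by auto
    then show ?thesis
      unfolding proper_flags_def flags_def chains_between_def subset_chain_def closure_empty[OF assms(3)]
      by (simp only: subset_Diff_insert Diff_empty mem_Collect_eq conj_ac)
  qed
  define P where "P = chain_sum (flats M) flats.\<kappa> \<F> {} ?E"
  have "poincare_fract M \<F> = to_fract P"
    unfolding P_def chain_sum_def poincare_fract_def proper_flags to_fract_sum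
  proof (intro sum.cong refl)
    fix \<G> assume "\<G> \<in> {\<G> \<in> chains_between (flats M) {} ?E. \<F> \<subseteq> \<G>}"
    then interpret matroid_flag M \<G> using assms by unfold_locales auto
    show "reduced_char_poly (flag_matroid M \<G>) / (q - 1) ^ card \<G> =
        to_fract (chain_weight flats.\<kappa> {} ?E \<G>)"
      by (rule reduced_char_poly_flag)
  qed
  \<comment> \<open>\<open>P\<close> satisfies the definite description, and injectivity of
    \<open>to_fract\<close> makes it the only such polynomial.\<close>
  then have P: "poincare_poly M \<F> = P"
    unfolding poincare_poly_def by simp
  have "{} \<in> flats M" "?E \<in> flats M"
    using closure_empty[OF assms(3)] subset_closure[of ?E] closure_subset_ground[of ?E]
    by (auto simp: flats_def)
  \<comment> \<open>The exponent on the right is \<open>rk M\<close> because the rank of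
    \<open>{}\<close> is 0.\<close>
  then have "q ^ Suc (card \<F>) * eval_int_poly P q = q ^ rk M * eval_int_poly P (inverse q)"
    using flats.chain_sum_palindromic[of "{}" ?E \<F> q] assms(2,4) q_neq_0 q_neq_1
    unfolding P_def proper_flags by (auto simp: rank_empty rk_def)
  then have "eval_int_poly P (inverse q) = q ^ Suc (card \<F>) / q ^ rk M * eval_int_poly P q"
    using q_neq_0 by (simp add: field_simps)
  also have "q ^ Suc (card \<F>) / q ^ rk M = q powi (int (Suc (card \<F>)) - int (rk M))"
    using q_neq_0 power_int_diff[of q "int (Suc (card \<F>))" "int (rk M)"]
    by (simp only: power_int_of_nat simp_thms)
  also have "int (Suc (card \<F>)) - int (rk M) = - (int (rk M) - 1 - int (card \<F>))" by simp
  finally show ?thesis unfolding P .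
qed

end
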